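(* Let $(\mathcal C,\mathbb E,\mathfrak s)$ be an extriangulated category, let $X\xrightarrow{f}Y\xrightarrow{g}Z\overset{\delta}{\dashrightarrow}$ and $L\xrightarrow{u}M\xrightarrow{v}N\overset{\varepsilon}{\dashrightarrow}$ be $\mathbb E$-triangles, and let $\alpha:X\to L$ and $\gamma:Z\to N$ be morphisms such that $\alpha_*\delta=\gamma^*\varepsilon$ and each of $\alpha,\gamma$ is both an $\mathbb E$-inflation and an $\mathbb E$-deflation. Then there is a morphism $\beta:Y\to M$ which is both an $\mathbb E$-inflation and an $\mathbb E$-deflation such that $(\alpha,\beta,\gamma)$ is a homotopic morphism of $\mathbb E$-triangles, and there are objects $K_\alpha,K_\beta,K_\gamma,C_\alpha,C_\beta,C_\gamma$ and a commutative diagram with the four rows $$K_\alpha\xrightarrow{f'}K_\beta\xrightarrow{g'}K_\gamma,\quad X\xrightarrow{f}Y\xrightarrow{g}Z,\quad L\xrightarrow{u}M\xrightarrow{v}N,\quad C_\alpha\xrightarrow{u'}C_\beta\xrightarrow{v'}C_\gamma$$ and the three columns $$K_\alpha\xrightarrow{i_\alpha}X\xrightarrow{\alpha}L\xrightarrow{p_\alpha}C_\alpha,\quad K_\beta\xrightarrow{i_\beta}Y\xrightarrow{\beta}M\xrightarrow{p_\beta}C_\beta,\quad K_\gamma\xrightarrow{i_\gamma}Z\xrightarrow{\gamma}N\xrightarrow{p_\gamma}C_\gamma,$$ together with a connecting morphism $z:K_\gamma\to C_\alpha$, such that the following are $\mathbb E$-triangles (for suitable $\mathbb E$-extensions): (1)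 $K_\alpha\xrightarrow{f'}K_\beta\xrightarrow{g'}K_\gamma\dashrightarrow$; (2) $K_\beta\xrightarrow{g'}K_\gamma\xrightarrow{z}C_\alpha\dashrightarrow$; (3) $K_\gamma\xrightarrow{z}C_\alpha\xrightarrow{u'}C_\beta\dashrightarrow$; (4) $C_\alpha\xrightarrow{u'}C_\beta\xrightarrow{v'}C_\gamma\dashrightarrow$; (5) $K_\alpha\xrightarrow{i_\alpha}X\xrightarrow{\alpha}L\dashrightarrow$; (6) $K_\beta\xrightarrow{i_\beta}Y\xrightarrow{\beta}M\dashrightarrow$; (7) $K_\gamma\xrightarrow{i_\gamma}Z\xrightarrow{\gamma}N\dashrightarrow$; (8) $X\xrightarrow{\alpha}L\xrightarrow{p_\alpha}C_\alpha\dashrightarrow$; (9) $Y\xrightarrow{\beta}M\xrightarrow{p_\beta}C_\beta\dashrightarrow$; (10) $Z\xrightarrow{\gamma}N\xrightarrow{p_\gamma}C_\gamma\dashrightarrow$; and such that, with respect to these $\mathbb E$-triangles and the two given ones, the following are morphisms of $\mathbb E$-triangles: $(\alpha,\beta,\gamma)$ (between the two given ones), $(i_\alpha,i_\beta,i_\gamma)$ (from (1) to the first given one), $(p_\alpha,p_\beta,p_\gamma)$ (from the second given one to (4)), $(f',f,u)$ (from (5) to (6)), $(f,u,u')$ (from (8) to (9)), $(g',g,v)$ (from (6) to (7)) and $(g,v,v')$ (from (9) to (10)). In particular, there is a sequence $$K_\alpha\xrightarrow{f'}K_\beta\xrightarrow{g'}K_\gamma\xrightarrow{z}C_\alpha\xrightarrow{u'}C_\beta\xrightarrow{v'}C_\gamma$$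 in which any three consecutive objects form an $\mathbb E$-triangle as in (1)–(4).
   Context: Extriangulated categories (Nakaoka–Palu). Let $\mathcal C$ be an additive category and $\mathbb E:\mathcal C^{\mathrm{op}}\times\mathcal C\to\mathbf{Ab}$ an additive bifunctor. An element $\delta\in\mathbb E(Z,X)$ is an $\mathbb E$-extension; write $f_*=\mathbb E(-,f)$ and $g^*=\mathbb E(g,-)$. Two sequences $X\to Y\to Z$ and $X\to Y'\to Z$ are equivalent if there is an isomorphism $Y\cong Y'$ compatible with the maps from $X$ and to $Z$. An additive realization $\mathfrak s$ assigns to each $\delta\in\mathbb E(Z,X)$ an equivalence class $\mathfrak s(\delta)=[X\xrightarrow{f}Y\xrightarrow{g}Z]$ such that: (i) if $\delta\in\mathbb E(Z,X)$, $\delta'\in\mathbb E(Z',X')$, $\alpha:X\to X'$, $\gamma:Z\to Z'$ satisfy $\alpha_*\delta=\gamma^*\delta'$, then for any representatives $X\xrightarrow{f}Y\xrightarrow{g}Z$ of $\mathfrak s(\delta)$ and $X'\xrightarrow{f'}Y'\xrightarrow{g'}Z'$ of $\mathfrak s(\delta')$ there is $\beta:Y\to Y'$ with $\beta f=f'\alpha$, $g'\beta=\gamma g$; (ii) $0\in\mathbb E(Z,X)$ is realized by the split sequence $X\to X\oplus Z\to Z$; (iii) $\mathfrak s(\delta\oplus\delta')=\mathfrak s(\delta)\oplus\mathfrak s(\delta')$. If $\mathfrak s(\delta)=[X\xrightarrow{f}Y\xrightarrow{g}Z]$, one writes $X\xrightarrow{f}Y\xrightarrow{g}Z\overset{\delta}{\dashrightarrow}$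 and calls it an $\mathbb E$-triangle, $f$ an $\mathbb E$-inflation, $g$ an $\mathbb E$-deflation. A morphism of $\mathbb E$-triangles from this one to $X'\xrightarrow{f'}Y'\xrightarrow{g'}Z'\overset{\delta'}{\dashrightarrow}$ is a triple $(\alpha,\beta,\gamma)$ with $\beta f=f'\alpha$, $g'\beta=\gamma g$, $\alpha_*\delta=\gamma^*\delta'$. $(\mathcal C,\mathbb E,\mathfrak s)$ is an extriangulated category if moreover: (ET3) for two such $\mathbb E$-triangles and $\alpha,\beta$ with $\beta f=f'\alpha$ there is $\gamma$ making $(\alpha,\beta,\gamma)$ a morphism of $\mathbb E$-triangles; (ET3$^{\mathrm{op}}$) given $\beta,\gamma$ with $\gamma g=g'\beta$ there is $\alpha$ making $(\alpha,\beta,\gamma)$ a morphism of $\mathbb E$-triangles; (ET4) given $\mathbb E$-triangles $A\xrightarrow{f}B\xrightarrow{g}D\overset{\delta}{\dashrightarrow}$ and $B\xrightarrow{u}C\xrightarrow{v}E\overset{\varepsilon}{\dashrightarrow}$ there are $\mathbb E$-triangles $A\xrightarrow{m}C\xrightarrow{h}F\overset{\theta}{\dashrightarrow}$ and $D\xrightarrow{w}F\xrightarrow{q}E\overset{\eta}{\dashrightarrow}$ with $m=uf$, $wg=hu$, $v=qh$, $w^*\theta=\delta$, $g_*\varepsilon=\eta$, $f_*\theta=q^*\varepsilon$; (ET4$^{\mathrm{op}}$) conversely, given the latter two $\mathbb E$-triangles there are $\mathbb E$-triangles of the former form satisfying the same six relations. Homotopic morphisms. A morphism $(\alpha,\beta,\gamma)$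 of $\mathbb E$-triangles from $X\xrightarrow{f}Y\xrightarrow{g}Z\overset{\delta}{\dashrightarrow}$ to $X'\xrightarrow{f'}Y'\xrightarrow{g'}Z'\overset{\delta'}{\dashrightarrow}$ is homotopic if there are an $\mathbb E$-triangle $X'\xrightarrow{s}E\xrightarrow{t}Z\overset{\eta}{\dashrightarrow}$ and morphisms $\beta_1:Y\to E$, $\beta_2:E\to Y'$ with $\beta=\beta_2\beta_1$, such that $(\alpha,\beta_1,1_Z)$ (from the first $\mathbb E$-triangle to this one) and $(1_{X'},\beta_2,\gamma)$ (from this one to the second) are morphisms of $\mathbb E$-triangles, and $X\xrightarrow{\left(\begin{smallmatrix}f\\ \alpha\end{smallmatrix}\right)}Y\oplus X'\xrightarrow{(\beta_1,-s)}E\overset{t^*\delta}{\dashrightarrow}$ and $E\xrightarrow{\left(\begin{smallmatrix}-t\\ \beta_2\end{smallmatrix}\right)}Z\oplus Y'\xrightarrow{(\gamma,g')}Z'\overset{s_*\delta'}{\dashrightarrow}$ are $\mathbb E$-triangles. *)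

theory Defs
  imports "HOL-Algebra.Group"
begin

section \<open>Additive categories\<close>

text \<open>Abelian groups are the commutative groups of HOL-Algebra, whose group operation is written
  multiplicatively.  So in the group \<open>Hom C X Y\<close> of morphisms from \<open>X\<close> to \<open>Y\<close> the sum of two
  morphisms is \<open>f \<otimes>\<^bsub>Hom C X Y\<^esub> g\<close>, the zero morphism is \<open>\<one>\<^bsub>Hom C X Y\<^esub>\<close>
  and \<open>-f\<close> is \<open>inv\<^bsub>Hom C X Y\<^esub> f\<close>; likewise for groups of extensions.\<close>

record ('o, 'm) cat_data =
  Ob :: "'o set"
  Hom :: "'o \<Rightarrow> 'o \<Rightarrow> 'm monoid"
  cmp :: "'m \<Rightarrow> 'm \<Rightarrow> 'm"  (infixl \<open>\<cdot>\<index>\<close> 75)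
  idt :: "'o \<Rightarrow> 'm"

abbreviation hom_set :: "('o, 'm, 'x) cat_data_scheme \<Rightarrow> 'o \<Rightarrow> 'o \<Rightarrow> 'm set"
  where "hom_set C X Y \<equiv> carrier (Hom C X Y)"

text \<open>Distinct hom-sets are disjoint, so that a morphism determines its source and target.\<close>

locale category =
  fixes C :: "('o, 'm, 'x) cat_data_scheme" (structure)
  assumes hom_disjoint:
      "\<lbrakk>X \<in> Ob C; Y \<in> Ob C; X' \<in> Ob C; Y' \<in> Ob C; f \<in> hom_set C X Y; f \<in> hom_set C X' Y'\<rbrakk>
        \<Longrightarrow> X = X' \<and> Y = Y'"
    and idt_hom: "X \<in> Ob C \<Longrightarrow> idt C X \<in> hom_set C X X"
    and cmp_hom:
      "\<lbrakk>X \<in> Ob C; Y \<in> Ob C; Z \<in> Ob C; f \<in> hom_set C X Y; g \<in> hom_set C Y Z\<rbrakk>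
        \<Longrightarrow> g \<cdot> f \<in> hom_set C X Z"
    and cmp_assoc:
      "\<lbrakk>W \<in> Ob C; X \<in> Ob C; Y \<in> Ob C; Z \<in> Ob C;
        f \<in> hom_set C W X; g \<in> hom_set C X Y; h \<in> hom_set C Y Z\<rbrakk>
        \<Longrightarrow> h \<cdot> g \<cdot> f = h \<cdot> (g \<cdot> f)"
    and cmp_idt_left: "\<lbrakk>X \<in> Ob C; Y \<in> Ob C; f \<in> hom_set C X Y\<rbrakk> \<Longrightarrow> idt C Y \<cdot> f = f"
    and cmp_idt_right: "\<lbrakk>X \<in> Ob C; Y \<in> Ob C; f \<in> hom_set C X Y\<rbrakk> \<Longrightarrow> f \<cdot> idt C X = f"

definition is_iso :: "('o, 'm, 'x) cat_data_scheme \<Rightarrow> 'o \<Rightarrow> 'o \<Rightarrow> 'm \<Rightarrow> bool"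
  where "is_iso C X Y f \<longleftrightarrow> f \<in> hom_set C X Y \<and>
    (\<exists>g \<in> hom_set C Y X. g \<cdot>\<^bsub>C\<^esub> f = idt C X \<and> f \<cdot>\<^bsub>C\<^esub> g = idt C Y)"

definition is_zero_object :: "('o, 'm, 'x) cat_data_scheme \<Rightarrow> 'o \<Rightarrow> bool"
  where "is_zero_object C O' \<longleftrightarrow> O' \<in> Ob C \<and>
    (\<forall>X \<in> Ob C. (\<exists>!f. f \<in> hom_set C O' X) \<and> (\<exists>!f. f \<in> hom_set C X O'))"

text \<open>\<open>is_biproduct C A B (P, i\<^sub>1, i\<^sub>2, p\<^sub>1, p\<^sub>2)\<close>: the object \<open>P\<close> is a direct sum \<open>A \<oplus> B\<close> with
  injections \<open>i\<^sub>1, i\<^sub>2\<close> and projections \<open>p\<^sub>1, p\<^sub>2\<close>.  No direct sums are chosen: every condition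
  below that mentions a direct sum is imposed for each such \<open>P\<close>.\<close>

type_synonym ('o, 'm) bip = "'o \<times> 'm \<times> 'm \<times> 'm \<times> 'm"

fun is_biproduct :: "('o, 'm, 'x) cat_data_scheme \<Rightarrow> 'o \<Rightarrow> 'o \<Rightarrow> ('o, 'm) bip \<Rightarrow> bool"
  where "is_biproduct C A B (P, i1, i2, p1, p2) \<longleftrightarrow>
    A \<in> Ob C \<and> B \<in> Ob C \<and> P \<in> Ob C \<and>
    i1 \<in> hom_set C A P \<and> i2 \<in> hom_set C B P \<and> p1 \<in> hom_set C P A \<and> p2 \<in> hom_set C P B \<and>
    p1 \<cdot>\<^bsub>C\<^esub> i1 = idt C A \<and> p2 \<cdot>\<^bsub>C\<^esub> i2 = idt C B \<and>
    p2 \<cdot>\<^bsub>C\<^esub> i1 = \<one>\<^bsub>Hom C A B\<^esub> \<and> p1 \<cdot>\<^bsub>C\<^esub> i2 = \<one>\<^bsub>Hom C B A\<^esub> \<and>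
    (i1 \<cdot>\<^bsub>C\<^esub> p1) \<otimes>\<^bsub>Hom C P P\<^esub> (i2 \<cdot>\<^bsub>C\<^esub> p2) = idt C P"

locale additive_category = category +
  assumes hom_group: "\<lbrakk>X \<in> Ob C; Y \<in> Ob C\<rbrakk> \<Longrightarrow> comm_group (Hom C X Y)"
    and cmp_add_left:
      "\<lbrakk>X \<in> Ob C; Y \<in> Ob C; Z \<in> Ob C;
        f \<in> hom_set C X Y; g \<in> hom_set C Y Z; g' \<in> hom_set C Y Z\<rbrakk>
        \<Longrightarrow> (g \<otimes>\<^bsub>Hom C Y Z\<^esub> g') \<cdot> f = (g \<cdot> f) \<otimes>\<^bsub>Hom C X Z\<^esub> (g' \<cdot> f)"
    and cmp_add_right:
      "\<lbrakk>X \<in> Ob C; Y \<in> Ob C; Z \<in> Ob C;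
        f \<in> hom_set C X Y; f' \<in> hom_set C X Y; g \<in> hom_set C Y Z\<rbrakk>
        \<Longrightarrow> g \<cdot> (f \<otimes>\<^bsub>Hom C X Y\<^esub> f') = (g \<cdot> f) \<otimes>\<^bsub>Hom C X Z\<^esub> (g \<cdot> f')"
    and zero_object_exists: "\<exists>O'. is_zero_object C O'"
    and biproduct_exists: "\<lbrakk>A \<in> Ob C; B \<in> Ob C\<rbrakk> \<Longrightarrow> \<exists>S. is_biproduct C A B S"

text \<open>For \<open>a : W \<rightarrow> A\<close> and \<open>b : W \<rightarrow> B\<close>, \<open>col C W S a b\<close> is the column \<open>(a; b) : W \<rightarrow> A \<oplus> B\<close>;
  for \<open>a : A \<rightarrow> W\<close> and \<open>b : B \<rightarrow> W\<close>, \<open>row C W S a b\<close> is the row \<open>(a, b) : A \<oplus> B \<rightarrow> W\<close>;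
  \<open>dsum C S T a b\<close> is \<open>a \<oplus> b\<close>, from the direct sum \<open>S\<close> to the direct sum \<open>T\<close>.\<close>

fun col :: "('o, 'm, 'x) cat_data_scheme \<Rightarrow> 'o \<Rightarrow> ('o, 'm) bip \<Rightarrow> 'm \<Rightarrow> 'm \<Rightarrow> 'm"
  where "col C W (P, i1, i2, p1, p2) a b = (i1 \<cdot>\<^bsub>C\<^esub> a) \<otimes>\<^bsub>Hom C W P\<^esub> (i2 \<cdot>\<^bsub>C\<^esub> b)"

fun row :: "('o, 'm, 'x) cat_data_scheme \<Rightarrow> 'o \<Rightarrow> ('o, 'm) bip \<Rightarrow> 'm \<Rightarrow> 'm \<Rightarrow> 'm"
  where "row C W (P, i1, i2, p1, p2) a b = (a \<cdot>\<^bsub>C\<^esub> p1) \<otimes>\<^bsub>Hom C P W\<^esub> (b \<cdot>\<^bsub>C\<^esub> p2)"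

fun dsum :: "('o, 'm, 'x) cat_data_scheme \<Rightarrow> ('o, 'm) bip \<Rightarrow> ('o, 'm) bip \<Rightarrow> 'm \<Rightarrow> 'm \<Rightarrow> 'm"
  where "dsum C (P, i1, i2, p1, p2) (Q, j1, j2, q1, q2) a b =
    (j1 \<cdot>\<^bsub>C\<^esub> a \<cdot>\<^bsub>C\<^esub> p1) \<otimes>\<^bsub>Hom C P Q\<^esub> (j2 \<cdot>\<^bsub>C\<^esub> b \<cdot>\<^bsub>C\<^esub> p2)"


section \<open>Extensions and realizations\<close>

text \<open>\<open>Ext C Z X\<close> is the group \<open>\<bbbE>(Z, X)\<close>; for \<open>g : Z' \<rightarrow> Z\<close> and \<open>f : X \<rightarrow> X'\<close>,
  \<open>Ext_map C g f\<close> is \<open>\<bbbE>(g, f) : \<bbbE>(Z, X) \<rightarrow> \<bbbE>(Z', X')\<close>.  A sequence \<open>X \<rightarrow> Y \<rightarrow> Z\<close> with given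
  end terms is a triple \<open>(f, Y, g)\<close>, and \<open>realize C Z X \<delta>\<close> is the class \<open>\<ss>(\<delta>)\<close> of
  \<open>\<delta> \<in> \<bbbE>(Z, X)\<close>.\<close>

record ('o, 'm, 'e) extri_data = "('o, 'm) cat_data" +
  Ext :: "'o \<Rightarrow> 'o \<Rightarrow> 'e monoid"
  Ext_map :: "'m \<Rightarrow> 'm \<Rightarrow> 'e \<Rightarrow> 'e"
  realize :: "'o \<Rightarrow> 'o \<Rightarrow> 'e \<Rightarrow> ('m \<times> 'o \<times> 'm) set"

locale additive_bifunctor = additive_category C
  for C :: "('o, 'm, 'e) extri_data" (structure) +
  assumes Ext_group: "\<lbrakk>Z \<in> Ob C; X \<in> Ob C\<rbrakk> \<Longrightarrow> comm_group (Ext C Z X)"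
    and Ext_map_hom:
      "\<lbrakk>Z \<in> Ob C; Z' \<in> Ob C; X \<in> Ob C; X' \<in> Ob C; g \<in> hom_set C Z' Z; f \<in> hom_set C X X'\<rbrakk>
        \<Longrightarrow> Ext_map C g f \<in> hom (Ext C Z X) (Ext C Z' X')"
    and Ext_map_idt:
      "\<lbrakk>Z \<in> Ob C; X \<in> Ob C; \<delta> \<in> carrier (Ext C Z X)\<rbrakk> \<Longrightarrow> Ext_map C (idt C Z) (idt C X) \<delta> = \<delta>"
    and Ext_map_cmp:
      "\<lbrakk>Z \<in> Ob C; Z' \<in> Ob C; Z'' \<in> Ob C; X \<in> Ob C; X' \<in> Ob C; X'' \<in> Ob C;
        g \<in> hom_set C Z' Z; g' \<in> hom_set C Z'' Z'; f \<in> hom_set C X X'; f' \<in> hom_set C X' X'';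
        \<delta> \<in> carrier (Ext C Z X)\<rbrakk>
        \<Longrightarrow> Ext_map C (g \<cdot> g') (f' \<cdot> f) \<delta> = Ext_map C g' f' (Ext_map C g f \<delta>)"
    and Ext_map_add_left:
      "\<lbrakk>Z \<in> Ob C; Z' \<in> Ob C; X \<in> Ob C; X' \<in> Ob C;
        g \<in> hom_set C Z' Z; h \<in> hom_set C Z' Z; f \<in> hom_set C X X'; \<delta> \<in> carrier (Ext C Z X)\<rbrakk>
        \<Longrightarrow> Ext_map C (g \<otimes>\<^bsub>Hom C Z' Z\<^esub> h) f \<delta> =
          Ext_map C g f \<delta> \<otimes>\<^bsub>Ext C Z' X'\<^esub> Ext_map C h f \<delta>"
    and Ext_map_add_right:
      "\<lbrakk>Z \<in> Ob C; Z' \<in> Ob C; X \<in> Ob C; X' \<in> Ob C;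
        g \<in> hom_set C Z' Z; f \<in> hom_set C X X'; h \<in> hom_set C X X'; \<delta> \<in> carrier (Ext C Z X)\<rbrakk>
        \<Longrightarrow> Ext_map C g (f \<otimes>\<^bsub>Hom C X X'\<^esub> h) \<delta> =
          Ext_map C g f \<delta> \<otimes>\<^bsub>Ext C Z' X'\<^esub> Ext_map C g h \<delta>"

text \<open>For \<open>\<delta> \<in> \<bbbE>(Z, X)\<close>, \<open>push C Z f \<delta>\<close> is \<open>f\<^sub>*\<delta>\<close> and \<open>pull C X g \<delta>\<close> is \<open>g\<^sup>*\<delta>\<close>; the object argument
  is the end of \<open>\<delta>\<close> that stays fixed.\<close>

definition push :: "('o, 'm, 'e) extri_data \<Rightarrow> 'o \<Rightarrow> 'm \<Rightarrow> 'e \<Rightarrow> 'e"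
  where "push C Z f \<delta> = Ext_map C (idt C Z) f \<delta>"

definition pull :: "('o, 'm, 'e) extri_data \<Rightarrow> 'o \<Rightarrow> 'm \<Rightarrow> 'e \<Rightarrow> 'e"
  where "pull C X g \<delta> = Ext_map C g (idt C X) \<delta>"

text \<open>With \<open>S = Z \<oplus> Z'\<close> and \<open>T = X \<oplus> X'\<close>, this is \<open>\<delta> \<oplus> \<delta>' \<in> \<bbbE>(Z \<oplus> Z', X \<oplus> X')\<close>: the element
  corresponding to \<open>(\<delta>, 0, 0, \<delta>')\<close> under the decomposition
  \<open>\<bbbE>(Z \<oplus> Z', X \<oplus> X') \<cong> \<bbbE>(Z, X) \<oplus> \<bbbE>(Z, X') \<oplus> \<bbbE>(Z', X) \<oplus> \<bbbE>(Z', X')\<close>.\<close>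

fun ext_dsum ::
    "('o, 'm, 'e) extri_data \<Rightarrow> ('o, 'm) bip \<Rightarrow> ('o, 'm) bip \<Rightarrow> 'e \<Rightarrow> 'e \<Rightarrow> 'e"
  where "ext_dsum C (P, i1, i2, p1, p2) (Q, j1, j2, q1, q2) \<delta> \<delta>' =
    Ext_map C p1 j1 \<delta> \<otimes>\<^bsub>Ext C P Q\<^esub> Ext_map C p2 j2 \<delta>'"

definition seqs :: "('o, 'm, 'x) cat_data_scheme \<Rightarrow> 'o \<Rightarrow> 'o \<Rightarrow> ('m \<times> 'o \<times> 'm) set"
  where "seqs C X Z = {(f, Y, g). Y \<in> Ob C \<and> f \<in> hom_set C X Y \<and> g \<in> hom_set C Y Z}"

definition seq_equiv ::
    "('o, 'm, 'x) cat_data_scheme \<Rightarrow> 'o \<Rightarrow> 'o \<Rightarrow> (('m \<times> 'o \<times> 'm) \<times> ('m \<times> 'o \<times> 'm)) set"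
  where "seq_equiv C X Z = {((f, Y, g), (f', Y', g')).
    (f, Y, g) \<in> seqs C X Z \<and> (f', Y', g') \<in> seqs C X Z \<and>
    (\<exists>b. is_iso C Y Y' b \<and> b \<cdot>\<^bsub>C\<^esub> f = f' \<and> g' \<cdot>\<^bsub>C\<^esub> b = g)}"

text \<open>A tuple \<open>(X, f, Y, g, Z, \<delta>)\<close> stands for \<open>X \<rightarrow> Y \<rightarrow> Z\<close> with maps \<open>f\<close>, \<open>g\<close> and extension
  \<open>\<delta> \<in> \<bbbE>(Z, X)\<close>.\<close>

type_synonym ('o, 'm, 'e) tri = "'o \<times> 'm \<times> 'o \<times> 'm \<times> 'o \<times> 'e"

fun E_triangle :: "('o, 'm, 'e) extri_data \<Rightarrow> ('o, 'm, 'e) tri \<Rightarrow> bool"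
  where "E_triangle C (X, f, Y, g, Z, \<delta>) \<longleftrightarrow>
    X \<in> Ob C \<and> Z \<in> Ob C \<and> \<delta> \<in> carrier (Ext C Z X) \<and> (f, Y, g) \<in> seqs C X Z \<and>
    realize C Z X \<delta> = seq_equiv C X Z `` {(f, Y, g)}"

definition E_inflation :: "('o, 'm, 'e) extri_data \<Rightarrow> 'm \<Rightarrow> bool"
  where "E_inflation C f \<longleftrightarrow> (\<exists>X Y g Z \<delta>. E_triangle C (X, f, Y, g, Z, \<delta>))"

definition E_deflation :: "('o, 'm, 'e) extri_data \<Rightarrow> 'm \<Rightarrow> bool"
  where "E_deflation C g \<longleftrightarrow> (\<exists>X f Y Z \<delta>. E_triangle C (X, f, Y, g, Z, \<delta>))"

fun tri_morphism ::
    "('o, 'm, 'e) extri_data \<Rightarrow> ('o, 'm, 'e) tri \<Rightarrow> ('o, 'm, 'e) tri \<Rightarrow> 'm \<times> 'm \<times> 'm \<Rightarrow> bool"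
  where "tri_morphism C (X, f, Y, g, Z, \<delta>) (X', f', Y', g', Z', \<delta>') (\<alpha>, \<beta>, \<gamma>) \<longleftrightarrow>
    E_triangle C (X, f, Y, g, Z, \<delta>) \<and> E_triangle C (X', f', Y', g', Z', \<delta>') \<and>
    \<alpha> \<in> hom_set C X X' \<and> \<beta> \<in> hom_set C Y Y' \<and> \<gamma> \<in> hom_set C Z Z' \<and>
    \<beta> \<cdot>\<^bsub>C\<^esub> f = f' \<cdot>\<^bsub>C\<^esub> \<alpha> \<and> g' \<cdot>\<^bsub>C\<^esub> \<beta> = \<gamma> \<cdot>\<^bsub>C\<^esub> g \<and> push C Z \<alpha> \<delta> = pull C X' \<gamma> \<delta>'"

locale additive_realization = additive_bifunctor +
  assumes realize_class:
      "\<lbrakk>Z \<in> Ob C; X \<in> Ob C; \<delta> \<in> carrier (Ext C Z X)\<rbrakk>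
        \<Longrightarrow> realize C Z X \<delta> \<in> seqs C X Z // seq_equiv C X Z"
    and realize_morphism:
      "\<lbrakk>E_triangle C (X, f, Y, g, Z, \<delta>); E_triangle C (X', f', Y', g', Z', \<delta>');
        \<alpha> \<in> hom_set C X X'; \<gamma> \<in> hom_set C Z Z'; push C Z \<alpha> \<delta> = pull C X' \<gamma> \<delta>'\<rbrakk>
        \<Longrightarrow> \<exists>\<beta> \<in> hom_set C Y Y'. \<beta> \<cdot> f = f' \<cdot> \<alpha> \<and> g' \<cdot> \<beta> = \<gamma> \<cdot> g"
    and realize_split:
      "is_biproduct C X Z (P, i1, i2, p1, p2)
        \<Longrightarrow> E_triangle C (X, i1, P, p2, Z, \<one>\<^bsub>Ext C Z X\<^esub>)"
    and realize_dsum: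
      "\<lbrakk>E_triangle C (X, f, Y, g, Z, \<delta>); E_triangle C (X', f', Y', g', Z', \<delta>');
        is_biproduct C X X' SX; is_biproduct C Y Y' SY; is_biproduct C Z Z' SZ\<rbrakk>
        \<Longrightarrow> E_triangle C (fst SX, dsum C SX SY f f', fst SY, dsum C SY SZ g g', fst SZ,
              ext_dsum C SZ SX \<delta> \<delta>')"


section \<open>Extriangulated categories\<close>

locale extriangulated_category = additive_realization +
  assumes ET3:
      "\<lbrakk>E_triangle C (X, f, Y, g, Z, \<delta>); E_triangle C (X', f', Y', g', Z', \<delta>');
        \<alpha> \<in> hom_set C X X'; \<beta> \<in> hom_set C Y Y'; \<beta> \<cdot> f = f' \<cdot> \<alpha>\<rbrakk>
        \<Longrightarrow> \<exists>\<gamma>. tri_morphism C (X, f, Y, g, Z, \<delta>) (X', f', Y', g', Z', \<delta>') (\<alpha>, \<beta>, \<gamma>)"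
    and ET3_op:
      "\<lbrakk>E_triangle C (X, f, Y, g, Z, \<delta>); E_triangle C (X', f', Y', g', Z', \<delta>');
        \<beta> \<in> hom_set C Y Y'; \<gamma> \<in> hom_set C Z Z'; \<gamma> \<cdot> g = g' \<cdot> \<beta>\<rbrakk>
        \<Longrightarrow> \<exists>\<alpha>. tri_morphism C (X, f, Y, g, Z, \<delta>) (X', f', Y', g', Z', \<delta>') (\<alpha>, \<beta>, \<gamma>)"
    and ET4:
      "\<lbrakk>E_triangle C (A, f, B, g, D, \<delta>); E_triangle C (B, u, G, v, H, \<epsilon>)\<rbrakk>
        \<Longrightarrow> \<exists>F m h w q \<theta> \<eta>.
          E_triangle C (A, m, G, h, F, \<theta>) \<and> E_triangle C (D, w, F, q, H, \<eta>) \<and>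
          m = u \<cdot> f \<and> w \<cdot> g = h \<cdot> u \<and> v = q \<cdot> h \<and>
          pull C A w \<theta> = \<delta> \<and> push C H g \<epsilon> = \<eta> \<and> push C F f \<theta> = pull C B q \<epsilon>"
    and ET4_op:
      "\<lbrakk>E_triangle C (A, m, G, h, F, \<theta>); E_triangle C (D, w, F, q, H, \<eta>)\<rbrakk>
        \<Longrightarrow> \<exists>B f g u v \<delta> \<epsilon>.
          E_triangle C (A, f, B, g, D, \<delta>) \<and> E_triangle C (B, u, G, v, H, \<epsilon>) \<and>
          m = u \<cdot> f \<and> w \<cdot> g = h \<cdot> u \<and> v = q \<cdot> h \<and>
          pull C A w \<theta> = \<delta> \<and> push C H g \<epsilon> = \<eta> \<and> push C F f \<theta> = pull C B q \<epsilon>"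

fun homotopic_morphism ::
    "('o, 'm, 'e) extri_data \<Rightarrow> ('o, 'm, 'e) tri \<Rightarrow> ('o, 'm, 'e) tri \<Rightarrow> 'm \<times> 'm \<times> 'm \<Rightarrow> bool"
  where "homotopic_morphism C (X, f, Y, g, Z, \<delta>) (X', f', Y', g', Z', \<delta>') (\<alpha>, \<beta>, \<gamma>) \<longleftrightarrow>
    tri_morphism C (X, f, Y, g, Z, \<delta>) (X', f', Y', g', Z', \<delta>') (\<alpha>, \<beta>, \<gamma>) \<and>
    (\<exists>s E t \<eta> \<beta>1 \<beta>2.
      E_triangle C (X', s, E, t, Z, \<eta>) \<and>
      \<beta>1 \<in> hom_set C Y E \<and> \<beta>2 \<in> hom_set C E Y' \<and> \<beta> = \<beta>2 \<cdot>\<^bsub>C\<^esub> \<beta>1 \<and>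
      tri_morphism C (X, f, Y, g, Z, \<delta>) (X', s, E, t, Z, \<eta>) (\<alpha>, \<beta>1, idt C Z) \<and>
      tri_morphism C (X', s, E, t, Z, \<eta>) (X', f', Y', g', Z', \<delta>') (idt C X', \<beta>2, \<gamma>) \<and>
      (\<forall>S. is_biproduct C Y X' S \<longrightarrow>
        E_triangle C (X, col C X S f \<alpha>, fst S, row C E S \<beta>1 (inv\<^bsub>Hom C X' E\<^esub> s), E,
          pull C X t \<delta>)) \<and>
      (\<forall>S. is_biproduct C Z Y' S \<longrightarrow>
        E_triangle C (E, col C E S (inv\<^bsub>Hom C E Z\<^esub> t) \<beta>2, fst S, row C Z' S \<gamma> g', Z',
          push C Z' s \<delta>')))"

end

theory Submission
  imports Defs
begin

text \<open>The construction rests on squares that are homotopy cartesian.  Call a commutative square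
  \<open>b f = s \<alpha>\<close> with \<open>f : X \<rightarrow> Y\<close>, \<open>\<alpha> : X \<rightarrow> L\<close>, \<open>b : Y \<rightarrow> E\<close>, \<open>s : L \<rightarrow> E\<close> homotopy cartesian if
  \<open>X \<rightarrow> Y \<oplus> L \<rightarrow> E\<close>, with maps \<open>(f; \<alpha>)\<close> and \<open>(b, -s)\<close>, is an \<open>\<bbbE>\<close>-triangle.  Such squares arise by
  pushing an \<open>\<bbbE>\<close>-triangle \<open>X \<rightarrow> Y \<rightarrow> Z\<close> forward along \<open>\<alpha>\<close> (lemma \<open>homotopy_square\<close>), and they
  transfer kernels and cokernels in the sense of \<open>\<bbbE>\<close>-triangles: if \<open>K \<rightarrow> X \<rightarrow> L\<close> is an \<open>\<bbbE>\<close>-triangle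
  on \<open>\<alpha>\<close>, then there is one \<open>K \<rightarrow> Y \<rightarrow> E\<close> on the opposite side \<open>b\<close> (lemma \<open>square_kernel\<close>), and if
  \<open>X \<rightarrow> L \<rightarrow> D\<close> is one, then there is one \<open>Y \<rightarrow> E \<rightarrow> D\<close> (lemma \<open>square_cokernel\<close>).  The lemmas also
  say how the extensions correspond.

  Now let \<open>L \<rightarrow> E \<rightarrow> Z\<close> realize \<open>\<alpha>\<^sub>*\<delta> = \<gamma>\<^sup>*\<epsilon>\<close>.  Pushing the first given \<open>\<bbbE>\<close>-triangle forward along \<open>\<alpha>\<close>
  gives \<open>\<beta>\<^sub>1 : Y \<rightarrow> E\<close>, which is an inflation and a deflation with the kernel and cokernel of \<open>\<alpha>\<close>;
  dually, pulling the second one back along \<open>\<gamma>\<close> gives \<open>\<beta>\<^sub>2 : E \<rightarrow> M\<close> with the kernel and cokernel of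
  \<open>\<gamma>\<close>.  The morphism wanted is \<open>\<beta> = \<beta>\<^sub>2 \<beta>\<^sub>1\<close>, and it is homotopic by construction.

  Let \<open>c : E \<rightarrow> C\<^sub>\<alpha>\<close> be the cokernel of \<open>\<beta>\<^sub>1\<close> and \<open>k : K\<^sub>\<gamma> \<rightarrow> E\<close> the kernel of \<open>\<beta>\<^sub>2\<close>.  The connecting
  morphism is \<open>z = c k\<close>.  Axiom (ET4) would supply \<open>\<bbbE>\<close>-triangles \<open>Y \<rightarrow> M \<rightarrow> C\<^sub>\<beta>\<close> and
  \<open>C\<^sub>\<alpha> \<rightarrow> C\<^sub>\<beta> \<rightarrow> C\<^sub>\<gamma>\<close>, but there is no reason why its map \<open>C\<^sub>\<alpha> \<rightarrow> C\<^sub>\<beta>\<close> should also be the second map of an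
  \<open>\<bbbE>\<close>-triangle \<open>K\<^sub>\<gamma> \<rightarrow> C\<^sub>\<alpha> \<rightarrow> C\<^sub>\<beta>\<close> starting with \<open>z\<close>.  Instead, \<open>E \<rightarrow> M \<rightarrow> C\<^sub>\<gamma>\<close> is pushed forward along \<open>c\<close>.
  This yields a homotopy cartesian square with corners \<open>E, M, C\<^sub>\<alpha>, C\<^sub>\<beta>\<close>, and transferring the kernel of
  \<open>c\<close> and the kernel of \<open>\<beta>\<^sub>2\<close> across that one square produces all three \<open>\<bbbE>\<close>-triangles with the same map
  \<open>C\<^sub>\<alpha> \<rightarrow> C\<^sub>\<beta>\<close> (lemma \<open>composite_cokernel\<close>).  The dual lemma \<open>composite_kernel\<close> provides \<open>K\<^sub>\<beta>\<close> and the
  remaining \<open>\<bbbE>\<close>-triangles, with the same \<open>z\<close>.  The seven morphisms of \<open>\<bbbE>\<close>-triangles are then read off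
  from the relations between the extensions.

  The axioms are self-dual, so every dual statement is obtained by passing to the opposite
  extriangulated category (theorem \<open>extriangulated_opp\<close>).\<close>

section \<open>Morphisms of an additive category\<close>

context additive_category
begin

text \<open>Since distinct hom-sets are disjoint, a morphism knows its source and its target.  With \<open>src\<close> and \<open>tgt\<close>
  as functions, the side conditions of all laws become equations between objects, which the simplifier
  settles by itself, and sums and negatives of morphisms need no index.\<close>

definition arr :: "'b \<Rightarrow> 'a \<Rightarrow> 'a \<Rightarrow> bool"
  where "arr f X Y \<longleftrightarrow> X \<in> Ob C \<and> Y \<in> Ob C \<and> f \<in> hom_set C X Y"

definition mor :: "'b \<Rightarrow> bool"
  where "mor f \<longleftrightarrow> (\<exists>X Y. arr f X Y)"

definition src :: "'b \<Rightarrow> 'a"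
  where "src f = (THE X. \<exists>Y. arr f X Y)"

definition tgt :: "'b \<Rightarrow> 'a"
  where "tgt f = (THE Y. \<exists>X. arr f X Y)"

definition add :: "'b \<Rightarrow> 'b \<Rightarrow> 'b"  (infixl \<open>\<oplus>\<close> 65)
  where "f \<oplus> g = f \<otimes>\<^bsub>Hom C (src f) (tgt f)\<^esub> g"

definition neg :: "'b \<Rightarrow> 'b"  (\<open>\<ominus> _\<close> [81] 80)
  where "\<ominus> f = inv\<^bsub>Hom C (src f) (tgt f)\<^esub> f"

definition zer :: "'a \<Rightarrow> 'a \<Rightarrow> 'b"
  where "zer X Y = \<one>\<^bsub>Hom C X Y\<^esub>"

lemma arr_unique: "arr f X Y \<Longrightarrow> arr f X' Y' \<Longrightarrow> X = X' \<and> Y = Y'"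
  unfolding arr_def using hom_disjoint by blast

lemma arr_src: "arr f X Y \<Longrightarrow> src f = X"
  unfolding src_def by (rule the_equality) (use arr_unique in blast)+

lemma arr_tgt: "arr f X Y \<Longrightarrow> tgt f = Y"
  unfolding tgt_def by (rule the_equality) (use arr_unique in blast)+

lemma arr_iff: "arr f X Y \<longleftrightarrow> mor f \<and> src f = X \<and> tgt f = Y"
  using arr_src arr_tgt unfolding mor_def by blast

lemma arrD: "arr f X Y \<Longrightarrow> mor f \<and> src f = X \<and> tgt f = Y \<and> X \<in> Ob C \<and> Y \<in> Ob C"
  using arr_iff arr_def by blast

lemma arrI: "X \<in> Ob C \<Longrightarrow> Y \<in> Ob C \<Longrightarrow> f \<in> hom_set C X Y \<Longrightarrow> arr f X Y"
  by (simp add: arr_def)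

lemma arr_hom: "arr f X Y \<Longrightarrow> f \<in> hom_set C X Y"
  by (simp add: arr_def)

lemma mor_arr: "mor f \<Longrightarrow> arr f (src f) (tgt f)"
  by (simp add: arr_iff)

lemma mor_Ob [simp]: "mor f \<Longrightarrow> src f \<in> Ob C" "mor f \<Longrightarrow> tgt f \<in> Ob C"
  using mor_arr arr_def by blast+

lemma mor_hom: "mor f \<Longrightarrow> src f = X \<Longrightarrow> tgt f = Y \<Longrightarrow> f \<in> hom_set C X Y"
  using mor_arr arr_def by blast

lemma arr_idt: "X \<in> Ob C \<Longrightarrow> arr (idt C X) X X"
  by (simp add: arr_def idt_hom)

lemma arr_cmp: "arr f X Y \<Longrightarrow> arr g Y Z \<Longrightarrow> arr (g \<cdot> f) X Z"
  unfolding arr_def using cmp_hom by blast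

lemma arr_add: "arr f X Y \<Longrightarrow> arr g X Y \<Longrightarrow> arr (f \<oplus> g) X Y"
  using hom_group[of X Y] arr_src[of f X Y] arr_tgt[of f X Y]
  unfolding arr_def add_def
  by (metis comm_group.axioms(2) group.is_monoid monoid.m_closed)

lemma arr_neg: "arr f X Y \<Longrightarrow> arr (\<ominus> f) X Y"
  using hom_group[of X Y] arr_src[of f X Y] arr_tgt[of f X Y]
  unfolding arr_def neg_def
  by (metis comm_group.axioms(2) group.inv_closed)

lemma arr_zer: "X \<in> Ob C \<Longrightarrow> Y \<in> Ob C \<Longrightarrow> arr (zer X Y) X Y"
  using hom_group[of X Y]
  unfolding arr_def zer_def
  by (metis comm_group.axioms(2) group.is_monoid monoid.one_closed)

lemma mor_simps [simp]:
  "X \<in> Ob C \<Longrightarrow> mor (idt C X)" "X \<in> Ob C \<Longrightarrow> src (idt C X) = X" "X \<in> Ob C \<Longrightarrow> tgt (idt C X) = X"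
  "\<lbrakk>mor f; mor g; src g = tgt f\<rbrakk> \<Longrightarrow> mor (g \<cdot> f)"
  "\<lbrakk>mor f; mor g; src g = tgt f\<rbrakk> \<Longrightarrow> src (g \<cdot> f) = src f"
  "\<lbrakk>mor f; mor g; src g = tgt f\<rbrakk> \<Longrightarrow> tgt (g \<cdot> f) = tgt g"
  "\<lbrakk>mor f; mor g; src f = src g; tgt f = tgt g\<rbrakk> \<Longrightarrow> mor (f \<oplus> g)"
  "\<lbrakk>mor f; mor g; src f = src g; tgt f = tgt g\<rbrakk> \<Longrightarrow> src (f \<oplus> g) = src g"
  "\<lbrakk>mor f; mor g; src f = src g; tgt f = tgt g\<rbrakk> \<Longrightarrow> tgt (f \<oplus> g) = tgt g"
  "mor f \<Longrightarrow> mor (\<ominus> f)" "mor f \<Longrightarrow> src (\<ominus> f) = src f" "mor f \<Longrightarrow> tgt (\<ominus> f) = tgt f"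
  "\<lbrakk>X \<in> Ob C; Y \<in> Ob C\<rbrakk> \<Longrightarrow> mor (zer X Y)"
  "\<lbrakk>X \<in> Ob C; Y \<in> Ob C\<rbrakk> \<Longrightarrow> src (zer X Y) = X"
  "\<lbrakk>X \<in> Ob C; Y \<in> Ob C\<rbrakk> \<Longrightarrow> tgt (zer X Y) = Y"
  using arr_idt[of X] arr_cmp[of f "src f" "tgt f" g "tgt g"]
    arr_add[of f "src f" "tgt f" g] arr_neg[of f "src f" "tgt f"] arr_zer[of X Y]
  by (auto simp: arr_iff)

lemma assoc [simp]:
  "\<lbrakk>mor f; mor g; mor h; src g = tgt f; src h = tgt g\<rbrakk> \<Longrightarrow> h \<cdot> g \<cdot> f = h \<cdot> (g \<cdot> f)"
  using cmp_assoc[of "src f" "tgt f" "tgt g" "tgt h" f g h] by (simp add: mor_hom)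

lemma idt_cmp [simp]: "\<lbrakk>mor f; tgt f = Y\<rbrakk> \<Longrightarrow> idt C Y \<cdot> f = f"
  using cmp_idt_left[of "src f" "tgt f" f] by (auto simp: mor_hom)

lemma cmp_idt [simp]: "\<lbrakk>mor f; src f = X\<rbrakk> \<Longrightarrow> f \<cdot> idt C X = f"
  using cmp_idt_right[of "src f" "tgt f" f] by (auto simp: mor_hom)

lemma distrib_right [simp]:
  "\<lbrakk>mor f; mor g; mor h; src g = tgt f; src h = tgt f; tgt g = tgt h\<rbrakk>
    \<Longrightarrow> (g \<oplus> h) \<cdot> f = g \<cdot> f \<oplus> h \<cdot> f"
  using cmp_add_left[of "src f" "tgt f" "tgt g" f g h] by (simp add: mor_hom add_def)

lemma distrib_left [simp]:
  "\<lbrakk>mor f; mor g; mor h; src h = tgt f; src f = src g; tgt f = tgt g\<rbrakk>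
    \<Longrightarrow> h \<cdot> (f \<oplus> g) = h \<cdot> f \<oplus> h \<cdot> g"
  using cmp_add_right[of "src f" "tgt f" "tgt h" f g h] by (simp add: mor_hom add_def)

lemma group_facts:
  assumes "arr f X Y" and "arr g X Y" and "arr h X Y"
  shows "f \<oplus> g = g \<oplus> f" and "f \<oplus> g \<oplus> h = f \<oplus> (g \<oplus> h)" and "zer X Y \<oplus> f = f"
    and "\<ominus> f \<oplus> f = zer X Y"
proof -
  interpret comm_group "Hom C X Y"
    using hom_group assms by (auto simp: arr_def)
  have [simp]: "f \<in> hom_set C X Y" "g \<in> hom_set C X Y" "h \<in> hom_set C X Y"
    using assms by (auto simp: arr_def)
  have [simp]: "src (zer X Y) = X" "tgt (zer X Y) = Y" "src f = X" "tgt f = Y" "src g = X"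
    "tgt g = Y" "src (f \<oplus> g) = X" "tgt (f \<oplus> g) = Y" "src (\<ominus> f) = X" "tgt (\<ominus> f) = Y"
    using assms[THEN arrD] by auto
  have a: "f' \<oplus> g' = f' \<otimes>\<^bsub>Hom C X Y\<^esub> g'" if "src f' = X" "tgt f' = Y" for f' g'
    using that by (simp add: add_def)
  show "f \<oplus> g = g \<oplus> f" by (simp add: a m_comm)
  show "f \<oplus> g \<oplus> h = f \<oplus> (g \<oplus> h)"
  proof -
    have "f \<oplus> g \<oplus> h = f \<otimes>\<^bsub>Hom C X Y\<^esub> g \<otimes>\<^bsub>Hom C X Y\<^esub> h"
      using a[of "f \<oplus> g" h] a[of f g] by (metis \<open>src (f \<oplus> g) = X\<close> \<open>tgt (f \<oplus> g) = Y\<close> \<open>src f = X\<close> \<open>tgt f = Y\<close>)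
    then show ?thesis by (simp add: a m_assoc)
  qed
  show "zer X Y \<oplus> f = f" using a[OF \<open>src (zer X Y) = X\<close> \<open>tgt (zer X Y) = Y\<close>] by (simp add: zer_def)
  show "\<ominus> f \<oplus> f = zer X Y"
    using a[OF \<open>src (\<ominus> f) = X\<close> \<open>tgt (\<ominus> f) = Y\<close>] by (simp add: zer_def neg_def)
qed

lemma add_comm: "\<lbrakk>mor f; mor g; src f = src g; tgt f = tgt g\<rbrakk> \<Longrightarrow> f \<oplus> g = g \<oplus> f"
  using group_facts(1)[of f "src f" "tgt f" g g] by (simp add: arr_iff)

lemma add_assoc [simp]:
  "\<lbrakk>mor f; mor g; mor h; src f = src g; tgt f = tgt g; src g = src h; tgt g = tgt h\<rbrakk>
    \<Longrightarrow> f \<oplus> g \<oplus> h = f \<oplus> (g \<oplus> h)"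
  using group_facts(2)[of f "src f" "tgt f" g h] by (simp add: arr_iff)

lemma add_left_comm:
  "\<lbrakk>mor f; mor g; mor h; src f = src g; tgt f = tgt g; src g = src h; tgt g = tgt h\<rbrakk>
    \<Longrightarrow> f \<oplus> (g \<oplus> h) = g \<oplus> (f \<oplus> h)"
  by (metis add_comm add_assoc)

lemma add_zer [simp]:
  "\<lbrakk>mor f; src f = X; tgt f = Y\<rbrakk> \<Longrightarrow> zer X Y \<oplus> f = f"
  "\<lbrakk>mor f; src f = X; tgt f = Y\<rbrakk> \<Longrightarrow> f \<oplus> zer X Y = f"
  using group_facts(3)[of f X Y f] group_facts(1)[of f X Y "zer X Y"] arr_zer[of X Y]
  by (metis arr_iff mor_Ob)+

lemma add_neg [simp]:
  "mor f \<Longrightarrow> \<ominus> f \<oplus> f = zer (src f) (tgt f)"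
  "mor f \<Longrightarrow> f \<oplus> \<ominus> f = zer (src f) (tgt f)"
  using group_facts(4)[of f "src f" "tgt f"] group_facts(1)[of f "src f" "tgt f" "\<ominus> f"]
  by (metis arr_iff arr_neg)+

lemma add_neg_left [simp]:
  "\<lbrakk>mor f; mor g; src g = src f; tgt g = tgt f\<rbrakk> \<Longrightarrow> \<ominus> f \<oplus> (f \<oplus> g) = g"
  "\<lbrakk>mor f; mor g; src g = src f; tgt g = tgt f\<rbrakk> \<Longrightarrow> f \<oplus> (\<ominus> f \<oplus> g) = g"
  by (subst add_assoc[symmetric]; simp)+

lemma neg_unique:
  "\<lbrakk>mor f; mor g; src f = src g; tgt f = tgt g; f \<oplus> g = zer (src f) (tgt f)\<rbrakk> \<Longrightarrow> g = \<ominus> f"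
  by (metis add_neg_left(1) add_zer(2) mor_simps(10-12))

lemma add_left_cancel:
  "\<lbrakk>mor f; mor g; mor h; src f = src g; tgt f = tgt g; src f = src h; tgt f = tgt h; f \<oplus> g = f \<oplus> h\<rbrakk>
    \<Longrightarrow> g = h"
  by (metis add_neg_left(1))

lemma cmp_zer [simp]:
  "\<lbrakk>mor f; tgt f = Y; Z \<in> Ob C\<rbrakk> \<Longrightarrow> zer Y Z \<cdot> f = zer (src f) Z"
  "\<lbrakk>mor f; src f = Y; X \<in> Ob C\<rbrakk> \<Longrightarrow> f \<cdot> zer X Y = zer X (tgt f)"
proof -
  have z: "h = zer (src h) (tgt h)" if "mor h" "h \<oplus> h = h" for h
    using that add_left_cancel[of h h "zer (src h) (tgt h)"] by (metis add_zer(2) mor_simps(13-15) mor_Ob)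
  show "zer Y Z \<cdot> f = zer (src f) Z" if [simp]: "mor f" "Z \<in> Ob C" and y: "tgt f = Y"
  proof -
    have "zer Y Z \<cdot> f \<oplus> zer Y Z \<cdot> f = zer Y Z \<cdot> f"
      unfolding y[symmetric] by (subst distrib_right[symmetric]) auto
    from z[OF _ this] show ?thesis unfolding y[symmetric] by simp
  qed
  show "f \<cdot> zer X Y = zer X (tgt f)" if [simp]: "mor f" "X \<in> Ob C" and y: "src f = Y"
  proof -
    have "f \<cdot> zer X Y \<oplus> f \<cdot> zer X Y = f \<cdot> zer X Y"
      unfolding y[symmetric] by (subst distrib_left[symmetric]) auto
    from z[OF _ this] show ?thesis unfolding y[symmetric] by simp
  qed
qed

lemma cmp_neg [simp]:
  "\<lbrakk>mor f; mor g; src g = tgt f\<rbrakk> \<Longrightarrow> \<ominus> g \<cdot> f = \<ominus> (g \<cdot> f)"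
  "\<lbrakk>mor f; mor g; src g = tgt f\<rbrakk> \<Longrightarrow> g \<cdot> \<ominus> f = \<ominus> (g \<cdot> f)"
proof -
  assume [simp]: "mor f" "mor g" "src g = tgt f"
  have "g \<cdot> f \<oplus> \<ominus> g \<cdot> f = zer (src g) (tgt g) \<cdot> f"
    by (subst distrib_right[symmetric]) auto
  then show "\<ominus> g \<cdot> f = \<ominus> (g \<cdot> f)"
    by (intro neg_unique) auto
  have "g \<cdot> f \<oplus> g \<cdot> \<ominus> f = g \<cdot> zer (src f) (tgt f)"
    by (subst distrib_left[symmetric]) auto
  then show "g \<cdot> \<ominus> f = \<ominus> (g \<cdot> f)"
    by (intro neg_unique) auto
qed

lemma neg_simps [simp]:
  "mor f \<Longrightarrow> \<ominus> (\<ominus> f) = f"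
  "\<lbrakk>X \<in> Ob C; Y \<in> Ob C\<rbrakk> \<Longrightarrow> \<ominus> zer X Y = zer X Y"
  "\<lbrakk>mor f; mor g; src f = src g; tgt f = tgt g\<rbrakk> \<Longrightarrow> \<ominus> (f \<oplus> g) = \<ominus> f \<oplus> \<ominus> g"
proof -
  show "mor f \<Longrightarrow> \<ominus> (\<ominus> f) = f"
    using neg_unique[of "\<ominus> f" f] by simp
  show "\<lbrakk>X \<in> Ob C; Y \<in> Ob C\<rbrakk> \<Longrightarrow> \<ominus> zer X Y = zer X Y"
    using neg_unique[of "zer X Y" "zer X Y"] by simp
  show "\<lbrakk>mor f; mor g; src f = src g; tgt f = tgt g\<rbrakk> \<Longrightarrow> \<ominus> (f \<oplus> g) = \<ominus> f \<oplus> \<ominus> g"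
    by (rule neg_unique[symmetric]) (auto simp: add_left_comm[of g "\<ominus> f"])
qed

text \<open>The simplifier brackets composites to the right.  There an equation \<open>g f = k\<close> no longer matches as soon as
  something is composed on the right; this form of it does.\<close>

lemma cmp_eq_assoc:
  "\<lbrakk>g \<cdot> f = k; mor f; mor g; mor x; src g = tgt f; src f = tgt x\<rbrakk> \<Longrightarrow> g \<cdot> (f \<cdot> x) = k \<cdot> x"
  using assoc[of x f g] by simp

end

section \<open>Isomorphisms and direct sums\<close>

context additive_category
begin

definition inverse_arrs :: "'b \<Rightarrow> 'b \<Rightarrow> 'a \<Rightarrow> 'a \<Rightarrow> bool"
  where "inverse_arrs b c Y Z \<longleftrightarrow>
    arr b Y Z \<and> arr c Z Y \<and> c \<cdot> b = idt C Y \<and> b \<cdot> c = idt C Z"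

lemma inverse_arrsD:
  assumes "inverse_arrs b c Y Z"
  shows "mor b \<and> src b = Y \<and> tgt b = Z \<and> mor c \<and> src c = Z \<and> tgt c = Y \<and> Y \<in> Ob C \<and> Z \<in> Ob C \<and>
    c \<cdot> b = idt C Y \<and> b \<cdot> c = idt C Z \<and>
    (\<forall>x. mor x \<longrightarrow> tgt x = Y \<longrightarrow> c \<cdot> (b \<cdot> x) = x) \<and> (\<forall>x. mor x \<longrightarrow> tgt x = Z \<longrightarrow> b \<cdot> (c \<cdot> x) = x)"
proof -
  have a: "arr b Y Z" "arr c Z Y" and e: "c \<cdot> b = idt C Y" "b \<cdot> c = idt C Z"
    using assms by (auto simp: inverse_arrs_def)
  note [simp] = a[THEN arrD]
  show ?thesis using cmp_eq_assoc[OF e(1)] cmp_eq_assoc[OF e(2)] e by auto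
qed

lemma inverse_arrs_sym: "inverse_arrs b c Y Z \<Longrightarrow> inverse_arrs c b Z Y"
  by (auto simp: inverse_arrs_def)

text \<open>If \<open>c b\<close> and \<open>b c\<close> are invertible, then \<open>b\<close> has a left inverse \<open>l c\<close> and a right inverse \<open>c r\<close>, and these
  coincide.\<close>

lemma inverse_of_split_both:
  assumes "arr b Y Z" "arr c Z Y" and "inverse_arrs (c \<cdot> b) l Y Y" and "inverse_arrs (b \<cdot> c) r Z Z"
  shows "inverse_arrs b (l \<cdot> c) Y Z"
proof -
  note [simp] = assms(1,2)[THEN arrD] assms(3,4)[THEN inverse_arrsD]
  have "l \<cdot> (c \<cdot> b) = idt C Y"
    using assms(3) unfolding inverse_arrs_def by blast
  moreover have "b \<cdot> (c \<cdot> r) = (b \<cdot> c) \<cdot> r"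
    by (rule assoc[symmetric]) simp_all
  then have "b \<cdot> (c \<cdot> r) = idt C Z"
    using assms(4) unfolding inverse_arrs_def by simp
  ultimately have [simp]: "l \<cdot> (c \<cdot> b) = idt C Y" "b \<cdot> (c \<cdot> r) = idt C Z" .
  have "b \<cdot> (l \<cdot> c) = b \<cdot> (l \<cdot> (c \<cdot> (b \<cdot> (c \<cdot> r))))" by simp
  also have "\<dots> = b \<cdot> ((l \<cdot> (c \<cdot> b)) \<cdot> (c \<cdot> r))"
    by (simp del: \<open>l \<cdot> (c \<cdot> b) = idt C Y\<close> \<open>b \<cdot> (c \<cdot> r) = idt C Z\<close>)
  also have "\<dots> = idt C Z" by simp
  finally show ?thesis by (simp add: inverse_arrs_def arr_iff)
qed

lemma inverse_id_plus_square_zero: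
  assumes "arr n Y Y" and "n \<cdot> n = zer Y Y"
  shows "inverse_arrs (idt C Y \<oplus> n) (idt C Y \<oplus> \<ominus> n) Y Y"
proof -
  note [simp] = assms(1)[THEN arrD] assms(2)
  show ?thesis by (simp add: inverse_arrs_def arr_iff)
qed

lemma
  assumes "is_biproduct C A B (P, i1, i2, p1, p2)"
  shows bipD: "mor i1 \<and> src i1 = A \<and> tgt i1 = P \<and> mor i2 \<and> src i2 = B \<and> tgt i2 = P \<and>
    mor p1 \<and> src p1 = P \<and> tgt p1 = A \<and> mor p2 \<and> src p2 = P \<and> tgt p2 = B \<and>
    A \<in> Ob C \<and> B \<in> Ob C \<and> P \<in> Ob C \<and>
    p1 \<cdot> i1 = idt C A \<and> p2 \<cdot> i2 = idt C B \<and> p2 \<cdot> i1 = zer A B \<and> p1 \<cdot> i2 = zer B A \<and>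
    (\<forall>x. mor x \<longrightarrow> tgt x = A \<longrightarrow> p1 \<cdot> (i1 \<cdot> x) = x) \<and>
    (\<forall>x. mor x \<longrightarrow> tgt x = B \<longrightarrow> p2 \<cdot> (i2 \<cdot> x) = x) \<and>
    (\<forall>x. mor x \<longrightarrow> tgt x = A \<longrightarrow> p2 \<cdot> (i1 \<cdot> x) = zer (src x) B) \<and>
    (\<forall>x. mor x \<longrightarrow> tgt x = B \<longrightarrow> p1 \<cdot> (i2 \<cdot> x) = zer (src x) A)" (is ?facts)
    and bip_sum: "i1 \<cdot> p1 \<oplus> i2 \<cdot> p2 = idt C P"
proof -
  have a: "arr i1 A P" "arr i2 B P" "arr p1 P A" "arr p2 P B" and
    e: "p1 \<cdot> i1 = idt C A" "p2 \<cdot> i2 = idt C B" "p2 \<cdot> i1 = zer A B" "p1 \<cdot> i2 = zer B A"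
    and s: "(i1 \<cdot> p1) \<otimes>\<^bsub>Hom C P P\<^esub> (i2 \<cdot> p2) = idt C P"
    using assms by (auto simp: arr_def zer_def is_biproduct.simps)
  note [simp] = a[THEN arrD]
  show ?facts using e e[THEN cmp_eq_assoc] by auto
  show "i1 \<cdot> p1 \<oplus> i2 \<cdot> p2 = idt C P" using s by (simp add: add_def)
qed

lemma bipI:
  assumes "arr i1 A P" "arr i2 B P" "arr p1 P A" "arr p2 P B"
    "p1 \<cdot> i1 = idt C A" "p2 \<cdot> i2 = idt C B" "p2 \<cdot> i1 = zer A B" "p1 \<cdot> i2 = zer B A"
    "i1 \<cdot> p1 \<oplus> i2 \<cdot> p2 = idt C P"
  shows "is_biproduct C A B (P, i1, i2, p1, p2)"
proof -
  note [simp] = assms(1-4)[THEN arrD]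
  show ?thesis
    using assms by (auto simp: arr_def zer_def is_biproduct.simps add_def)
qed

lemma bip_swap:
  assumes "is_biproduct C A B (P, i1, i2, p1, p2)"
  shows "is_biproduct C B A (P, i2, i1, p2, p1)"
proof -
  note b = assms[THEN bipD] assms[THEN bip_sum]
  show ?thesis using b by (intro bipI) (auto simp: arr_iff add_comm)
qed

lemma obtain_biproduct:
  assumes "A \<in> Ob C" "B \<in> Ob C"
  obtains P i1 i2 p1 p2 where "is_biproduct C A B (P, i1, i2, p1, p2)"
  using biproduct_exists[OF assms] by (metis prod_cases5)

text \<open>A direct sum with a zero object can be taken to be the other summand itself, which turns the axioms on
  direct sums and split sequences into statements about single objects.\<close>

lemma zero_biproduct:
  obtains O' where "O' \<in> Ob C"
    and "\<And>X. X \<in> Ob C \<Longrightarrow> is_biproduct C X O' (X, idt C X, zer O' X, idt C X, zer X O')"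
proof -
  obtain O' where z: "is_zero_object C O'" using zero_object_exists by blast
  then have [simp]: "O' \<in> Ob C" by (simp add: is_zero_object_def)
  have "idt C O' = zer O' O'"
    using z idt_hom[of O'] arr_zer[of O' O', THEN arr_hom] unfolding is_zero_object_def by blast
  then have "is_biproduct C X O' (X, idt C X, zer O' X, idt C X, zer X O')" if "X \<in> Ob C" for X
    using that by (intro bipI) (auto simp: arr_iff)
  then show thesis by (rule that[OF \<open>O' \<in> Ob C\<close>])
qed

end

section \<open>Pushing and pulling extensions\<close>

context additive_bifunctor
begin

lemma ext_closed [simp]:
  "\<lbrakk>\<delta> \<in> carrier (Ext C Z (src f)); Z \<in> Ob C; mor f; tgt f = Y\<rbrakk>
    \<Longrightarrow> push C Z f \<delta> \<in> carrier (Ext C Z Y)"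
  "\<lbrakk>\<delta> \<in> carrier (Ext C (tgt g) X); X \<in> Ob C; mor g; src g = W\<rbrakk>
    \<Longrightarrow> pull C X g \<delta> \<in> carrier (Ext C W X)"
  using Ext_map_hom[of Z Z "src f" Y "idt C Z" f] Ext_map_hom[of "tgt g" W X X g "idt C X"]
  by (auto simp: push_def pull_def hom_def Pi_iff idt_hom mor_hom)

lemma push_idt [simp]:
  "\<lbrakk>\<delta> \<in> carrier (Ext C Z X); Z \<in> Ob C; X \<in> Ob C\<rbrakk> \<Longrightarrow> push C Z (idt C X) \<delta> = \<delta>"
  "\<lbrakk>\<delta> \<in> carrier (Ext C Z X); Z \<in> Ob C; X \<in> Ob C\<rbrakk> \<Longrightarrow> pull C X (idt C Z) \<delta> = \<delta>"
  by (simp_all add: push_def pull_def Ext_map_idt)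

lemma push_cmp [simp]:
  assumes "\<delta> \<in> carrier (Ext C Z (src f))" "Z \<in> Ob C" "mor f" "mor f'" "src f' = tgt f"
  shows "push C Z (f' \<cdot> f) \<delta> = push C Z f' (push C Z f \<delta>)"
  using assms Ext_map_cmp[of Z Z Z "src f" "tgt f" "tgt f'" "idt C Z" "idt C Z" f f' \<delta>]
  by (simp add: push_def idt_hom mor_hom)

lemma pull_cmp [simp]:
  assumes "\<delta> \<in> carrier (Ext C (tgt g) X)" "X \<in> Ob C" "mor g" "mor g'" "src g = tgt g'"
  shows "pull C X (g \<cdot> g') \<delta> = pull C X g' (pull C X g \<delta>)"
  using assms Ext_map_cmp[of "tgt g" "tgt g'" "src g'" X X X g g' "idt C X" "idt C X" \<delta>]
  by (simp add: pull_def idt_hom mor_hom)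

lemma pull_push [simp]:
  assumes "\<delta> \<in> carrier (Ext C Z (src f))" "mor f" "mor g" "tgt g = Z" "tgt f = Y"
  shows "pull C Y g (push C Z f \<delta>) = push C (src g) f (pull C (src f) g \<delta>)"
  using assms Ext_map_cmp[of Z Z "src g" "src f" Y Y "idt C Z" g f "idt C Y" \<delta>]
    Ext_map_cmp[of Z "src g" "src g" "src f" "src f" Y g "idt C (src g)" "idt C (src f)" f \<delta>]
  by (auto simp: pull_def push_def idt_hom mor_hom)

lemma ext_one:
  assumes "mor f" "mor g"
  shows "Ext_map C g f \<one>\<^bsub>Ext C (tgt g) (src f)\<^esub> = \<one>\<^bsub>Ext C (src g) (tgt f)\<^esub>"
proof (rule hom_one)
  show "Ext_map C g f \<in> hom (Ext C (tgt g) (src f)) (Ext C (src g) (tgt f))"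
    using assms by (intro Ext_map_hom) (auto simp: mor_hom)
  show "group (Ext C (tgt g) (src f))" "group (Ext C (src g) (tgt f))"
    using assms Ext_group by (simp_all add: comm_group.axioms(2))
qed

lemma ext_one_simps [simp]:
  "\<lbrakk>mor f; Z \<in> Ob C; src f = X\<rbrakk> \<Longrightarrow> push C Z f \<one>\<^bsub>Ext C Z X\<^esub> = \<one>\<^bsub>Ext C Z (tgt f)\<^esub>"
  "\<lbrakk>mor g; X \<in> Ob C; tgt g = Z\<rbrakk> \<Longrightarrow> pull C X g \<one>\<^bsub>Ext C Z X\<^esub> = \<one>\<^bsub>Ext C (src g) X\<^esub>"
  "\<lbrakk>Z \<in> Ob C; X \<in> Ob C\<rbrakk> \<Longrightarrow> \<one>\<^bsub>Ext C Z X\<^esub> \<in> carrier (Ext C Z X)"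
  using ext_one[of f "idt C Z"] ext_one[of "idt C X" g] Ext_group[of Z X]
  by (auto simp: push_def pull_def comm_group_def group_def monoid.one_closed)

lemma push_add:
  assumes "\<delta> \<in> carrier (Ext C Z (src f))" "Z \<in> Ob C" "mor f" "mor f'" "src f' = src f" "tgt f' = tgt f"
  shows "push C Z (f \<oplus> f') \<delta> = push C Z f \<delta> \<otimes>\<^bsub>Ext C Z (tgt f)\<^esub> push C Z f' \<delta>"
  using assms Ext_map_add_right[of Z Z "src f" "tgt f" "idt C Z" f f' \<delta>]
  by (simp add: push_def add_def idt_hom mor_hom)

lemma pull_add:
  assumes "\<delta> \<in> carrier (Ext C (tgt g) X)" "X \<in> Ob C" "mor g" "mor g'" "src g' = src g" "tgt g' = tgt g"
  shows "pull C X (g \<oplus> g') \<delta> = pull C X g \<delta> \<otimes>\<^bsub>Ext C (src g) X\<^esub> pull C X g' \<delta>"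
  using assms Ext_map_add_left[of "tgt g" "src g" X X g g' "idt C X" \<delta>]
  by (simp add: pull_def add_def idt_hom mor_hom)

lemma ext_mult [simp]:
  assumes "\<delta> \<in> carrier (Ext C Z X)" "Z \<in> Ob C" "X \<in> Ob C"
  shows "\<one>\<^bsub>Ext C Z X\<^esub> \<otimes>\<^bsub>Ext C Z X\<^esub> \<delta> = \<delta>" "\<delta> \<otimes>\<^bsub>Ext C Z X\<^esub> \<one>\<^bsub>Ext C Z X\<^esub> = \<delta>"
  using assms Ext_group[of Z X] by (simp_all add: comm_group_def group_def monoid.l_one monoid.r_one)

lemma ext_idem:
  assumes "\<delta> \<in> carrier (Ext C Z X)" "Z \<in> Ob C" "X \<in> Ob C" "\<delta> \<otimes>\<^bsub>Ext C Z X\<^esub> \<delta> = \<delta>"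
  shows "\<delta> = \<one>\<^bsub>Ext C Z X\<^esub>"
  using assms Ext_group[of Z X] by (metis comm_group.axioms(2) group.l_cancel_one')

lemma push_zer [simp]:
  assumes "\<delta> \<in> carrier (Ext C Z X)" "Z \<in> Ob C" "X \<in> Ob C" "Y \<in> Ob C"
  shows "push C Z (zer X Y) \<delta> = \<one>\<^bsub>Ext C Z Y\<^esub>"
  using push_add[of \<delta> Z "zer X Y" "zer X Y"] assms by (intro ext_idem) simp_all

lemma pull_zer [simp]:
  assumes "\<delta> \<in> carrier (Ext C Z X)" "Z \<in> Ob C" "X \<in> Ob C" "W \<in> Ob C"
  shows "pull C X (zer W Z) \<delta> = \<one>\<^bsub>Ext C W X\<^esub>"
  using pull_add[of \<delta> "zer W Z" X "zer W Z"] assms by (intro ext_idem) simp_all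

lemma push_neg:
  assumes "\<delta> \<in> carrier (Ext C Z (src f))" "Z \<in> Ob C" "mor f" "tgt f = Y"
  shows "push C Z (\<ominus> f) \<delta> = inv\<^bsub>Ext C Z Y\<^esub> push C Z f \<delta>"
proof -
  interpret comm_group "Ext C Z Y" using assms Ext_group by auto
  show ?thesis
  proof (rule inv_equality[symmetric])
    have "push C Z (\<ominus> f) \<delta> \<otimes>\<^bsub>Ext C Z (tgt (\<ominus> f))\<^esub> push C Z f \<delta> = push C Z (\<ominus> f \<oplus> f) \<delta>"
      by (rule push_add[symmetric]) (use assms in simp_all)
    then show "push C Z (\<ominus> f) \<delta> \<otimes>\<^bsub>Ext C Z Y\<^esub> push C Z f \<delta> = \<one>\<^bsub>Ext C Z Y\<^esub>"
      using assms mor_Ob[of f] by simp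
  qed (use assms in simp_all)
qed

lemma pull_neg:
  assumes "\<delta> \<in> carrier (Ext C (tgt g) X)" "X \<in> Ob C" "mor g" "src g = W"
  shows "pull C X (\<ominus> g) \<delta> = inv\<^bsub>Ext C W X\<^esub> pull C X g \<delta>"
proof -
  interpret comm_group "Ext C W X" using assms Ext_group by auto
  show ?thesis
  proof (rule inv_equality[symmetric])
    have "pull C X (\<ominus> g) \<delta> \<otimes>\<^bsub>Ext C (src (\<ominus> g)) X\<^esub> pull C X g \<delta> = pull C X (\<ominus> g \<oplus> g) \<delta>"
      by (rule pull_add[symmetric]) (use assms in simp_all)
    then show "pull C X (\<ominus> g) \<delta> \<otimes>\<^bsub>Ext C W X\<^esub> pull C X g \<delta> = \<one>\<^bsub>Ext C W X\<^esub>"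
      using assms mor_Ob[of g] by simp
  qed (use assms in simp_all)
qed

text \<open>Pushing along \<open>-f\<close> and pulling along \<open>-g\<close> both invert the extension, so the two signs cancel.\<close>

lemma pull_neg_push_neg:
  assumes "\<delta> \<in> carrier (Ext C (tgt g) (src f))" "mor g" "mor f"
  shows "pull C (tgt f) (\<ominus> g) (push C (tgt g) (\<ominus> f) \<delta>) = pull C (tgt f) g (push C (tgt g) f \<delta>)"
proof -
  interpret comm_group "Ext C (src g) (tgt f)" using assms Ext_group mor_Ob by auto
  have "push C (src g) f (pull C (src f) g \<delta>) \<in> carrier (Ext C (src g) (tgt f))"
    using assms by simp
  note i = inv_inv[OF this]
  have "pull C (tgt f) (\<ominus> g) (push C (tgt g) (\<ominus> f) \<delta>) =
      inv\<^bsub>Ext C (src g) (tgt f)\<^esub> pull C (tgt f) g (push C (tgt g) (\<ominus> f) \<delta>)"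
    using assms by (intro pull_neg) simp_all
  also have "pull C (tgt f) g (push C (tgt g) (\<ominus> f) \<delta>) = push C (src g) (\<ominus> f) (pull C (src f) g \<delta>)"
    using assms by simp
  also have "\<dots> = inv\<^bsub>Ext C (src g) (tgt f)\<^esub> push C (src g) f (pull C (src f) g \<delta>)"
    using assms by (intro push_neg) simp_all
  finally show ?thesis unfolding i using assms by simp
qed

end

section \<open>The opposite extriangulated category\<close>

context additive_category
begin

lemma seq_equivI:
  assumes "arr f X Y" "arr g Y Z" "arr f' X Y'" "arr g' Y' Z" "arr b Y Y'" "arr b' Y' Y"
    "b' \<cdot> b = idt C Y" "b \<cdot> b' = idt C Y'" "b \<cdot> f = f'" "g' \<cdot> b = g"
  shows "((f, Y, g), (f', Y', g')) \<in> seq_equiv C X Z"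
  using assms unfolding seq_equiv_def seqs_def is_iso_def arr_def by auto

lemma seq_equivE:
  assumes "((f, Y, g), (f', Y', g')) \<in> seq_equiv C X Z" and "X \<in> Ob C" "Z \<in> Ob C"
  obtains b b' where "arr f X Y" "arr g Y Z" "arr f' X Y'" "arr g' Y' Z" "arr b Y Y'" "arr b' Y' Y"
    "b' \<cdot> b = idt C Y" "b \<cdot> b' = idt C Y'" "b \<cdot> f = f'" "g' \<cdot> b = g" "b' \<cdot> f' = f" "g \<cdot> b' = g'"
proof -
  from assms(1) obtain b b' where a: "arr f X Y" "arr g Y Z" "arr f' X Y'" "arr g' Y' Z"
      "arr b Y Y'" "arr b' Y' Y"
    and e: "b' \<cdot> b = idt C Y" "b \<cdot> b' = idt C Y'" "b \<cdot> f = f'" "g' \<cdot> b = g"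
    using assms(2,3) unfolding seq_equiv_def seqs_def is_iso_def arr_def by auto
  note [simp] = a[THEN arrD]
  have "b' \<cdot> f' = f" "g \<cdot> b' = g'"
    using e(1) cmp_eq_assoc[of b' b "idt C Y" f] e(2,3) cmp_assoc assoc[of b' b g'] e(4) by auto
  with a e show thesis by (intro that)
qed

text \<open>An extension determines an equivalence class of sequences, so any two realizations are related by an
  isomorphism once equivalence of sequences is known to be symmetric and transitive.\<close>

lemma equiv_seq_equiv:
  assumes [simp]: "X \<in> Ob C" "Z \<in> Ob C"
  shows "equiv (seqs C X Z) (seq_equiv C X Z)"
proof (rule equivI)
  show "seq_equiv C X Z \<subseteq> seqs C X Z \<times> seqs C X Z"
    by (auto simp: seq_equiv_def)
  show "refl_on (seqs C X Z) (seq_equiv C X Z)"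
  proof (rule refl_onI)
    fix T assume "T \<in> seqs C X Z"
    then obtain f Y g where T: "T = (f, Y, g)" and a: "arr f X Y" "arr g Y Z"
      by (auto simp: seqs_def arr_def)
    note [simp] = a[THEN arrD]
    show "(T, T) \<in> seq_equiv C X Z"
      unfolding T by (rule seq_equivI[where b = "idt C Y" and b' = "idt C Y"])
        (auto simp: arr_iff)
  qed
  show "sym (seq_equiv C X Z)"
  proof (rule symI)
    fix T T' assume e: "(T, T') \<in> seq_equiv C X Z"
    obtain f Y g f' Y' g' where [simp]: "T = (f, Y, g)" "T' = (f', Y', g')"
      by (cases T, cases T')
    show "(T', T) \<in> seq_equiv C X Z"
      using e by (auto elim!: seq_equivE intro: seq_equivI)
  qed
  show "trans (seq_equiv C X Z)"
  proof (rule transI)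
    fix T T' T'' assume e: "(T, T') \<in> seq_equiv C X Z" "(T', T'') \<in> seq_equiv C X Z"
    obtain f Y g f' Y' g' f'' Y'' g''
      where T: "T = (f, Y, g)" "T' = (f', Y', g')" "T'' = (f'', Y'', g'')"
      by (cases T, cases T', cases T'')
    from e(1) obtain b b' where a: "arr f X Y" "arr g Y Z" "arr f' X Y'" "arr g' Y' Z" "arr b Y Y'"
        "arr b' Y' Y" and b: "b' \<cdot> b = idt C Y" "b \<cdot> b' = idt C Y'" "b \<cdot> f = f'" "g' \<cdot> b = g"
      unfolding T by (auto elim!: seq_equivE)
    from e(2) obtain c c' where a': "arr f'' X Y''" "arr g'' Y'' Z" "arr c Y' Y''"
        "arr c' Y'' Y'" and c: "c' \<cdot> c = idt C Y'" "c \<cdot> c' = idt C Y''" "c \<cdot> f' = f''" "g'' \<cdot> c = g'"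
      unfolding T by (auto elim!: seq_equivE)
    note [simp] = a[THEN arrD] a'[THEN arrD] b c b[THEN cmp_eq_assoc] c[THEN cmp_eq_assoc]
    show "(T, T'') \<in> seq_equiv C X Z"
      unfolding T by (rule seq_equivI[where b = "c \<cdot> b" and b' = "b' \<cdot> c'"]) (auto simp: arr_iff)
  qed
qed

end

text \<open>The opposite of an extriangulated category keeps the objects and exchanges the two ends of everything
  else: hom-sets, extension groups and sequences.\<close>

definition opp :: "('o, 'm, 'e) extri_data \<Rightarrow> ('o, 'm, 'e) extri_data"
  where "opp C = \<lparr>Ob = Ob C, Hom = (\<lambda>X Y. Hom C Y X), cmp = (\<lambda>g f. cmp C f g), idt = idt C,
    Ext = (\<lambda>Z X. Ext C X Z), Ext_map = (\<lambda>g f. Ext_map C f g),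
    realize = (\<lambda>Z X \<delta>. {(f, Y, g). (g, Y, f) \<in> realize C X Z \<delta>})\<rparr>"

lemma opp_sel [simp]:
  "Ob (opp C) = Ob C" "Hom (opp C) X Y = Hom C Y X" "cmp (opp C) g f = cmp C f g"
  "idt (opp C) = idt C" "Ext (opp C) Z X = Ext C X Z" "Ext_map (opp C) g f = Ext_map C f g"
  "realize (opp C) Z X \<delta> = {(f, Y, g). (g, Y, f) \<in> realize C X Z \<delta>}"
  by (simp_all add: opp_def)

lemma opp_push_pull [simp]:
  "push (opp C) Z f \<delta> = pull C Z f \<delta>" "pull (opp C) X g \<delta> = push C X g \<delta>"
  by (simp_all add: push_def pull_def)

lemma seqs_opp: "(f, Y, g) \<in> seqs (opp C) X Z \<longleftrightarrow> (g, Y, f) \<in> seqs C Z X"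
  by (auto simp: seqs_def)

lemma (in additive_bifunctor) seq_equiv_opp:
  assumes [simp]: "X \<in> Ob C" "Z \<in> Ob C"
  shows "((f, Y, g), (f', Y', g')) \<in> seq_equiv (opp C) X Z \<longleftrightarrow>
    ((g, Y, f), (g', Y', f')) \<in> seq_equiv C Z X" (is "?l \<longleftrightarrow> ?r")
proof
  assume ?l
  then obtain b b' where a: "arr g Z Y" "arr f Y X" "arr g' Z Y'" "arr f' Y' X" "arr b Y' Y"
      "arr b' Y Y'" and e: "b' \<cdot> b = idt C Y'" "b \<cdot> b' = idt C Y" "f \<cdot> b = f'" "b \<cdot> g' = g"
    by (auto simp: seq_equiv_def seqs_def is_iso_def arr_def)
  note [simp] = a[THEN arrD]
  have "b' \<cdot> g = g'" "f' \<cdot> b' = f"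
    using e(1) cmp_eq_assoc[of b' b "idt C Y'" g'] e assoc[of b' b f] by auto
  then show ?r
    using a e by (intro seq_equivI[where b = b' and b' = b]) auto
next
  assume ?r
  then obtain b b' where a: "arr g Z Y" "arr f Y X" "arr g' Z Y'" "arr f' Y' X" "arr b Y Y'"
    "arr b' Y' Y" "b' \<cdot> b = idt C Y" "b \<cdot> b' = idt C Y'" "b \<cdot> g = g'" "f' \<cdot> b = f" "b' \<cdot> g' = g"
    "f \<cdot> b' = f'"
    by (rule seq_equivE) auto
  then show ?l
    by (auto simp: seq_equiv_def seqs_def is_iso_def arr_def)
qed

text \<open>An isomorphism between the middle terms of two opposite sequences is inverse to one between the original
  sequences, so reversing sequences maps equivalence classes onto equivalence classes.\<close>

lemma (in additive_bifunctor) E_triangle_opp: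
  "E_triangle (opp C) (X, f, Y, g, Z, \<delta>) \<longleftrightarrow> E_triangle C (Z, g, Y, f, X, \<delta>)"
proof (cases "X \<in> Ob C \<and> Z \<in> Ob C")
  case True
  then have [simp]: "X \<in> Ob C" "Z \<in> Ob C" by auto
  define flip :: "'m \<times> 'o \<times> 'm \<Rightarrow> 'm \<times> 'o \<times> 'm" where "flip = (\<lambda>(f, Y, g). (g, Y, f))"
  have inv: "flip (flip T) = T" for T by (cases T) (simp add: flip_def)
  have r: "realize (opp C) Z X \<delta> = flip ` realize C X Z \<delta>"
    by (force simp: flip_def)
  have e: "seq_equiv (opp C) X Z `` {(f, Y, g)} = flip ` (seq_equiv C Z X `` {(g, Y, f)})"
  proof (intro Set.set_eqI iffI)
    fix T assume "T \<in> seq_equiv (opp C) X Z `` {(f, Y, g)}"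
    then show "T \<in> flip ` (seq_equiv C Z X `` {(g, Y, f)})"
      by (cases T) (force simp: seq_equiv_opp flip_def)
  next
    fix T assume "T \<in> flip ` (seq_equiv C Z X `` {(g, Y, f)})"
    then show "T \<in> seq_equiv (opp C) X Z `` {(f, Y, g)}"
      by (cases T) (force simp: seq_equiv_opp flip_def)
  qed
  have "inj flip" by (metis inv injI)
  then have "realize (opp C) Z X \<delta> = seq_equiv (opp C) X Z `` {(f, Y, g)} \<longleftrightarrow>
      realize C X Z \<delta> = seq_equiv C Z X `` {(g, Y, f)}"
    unfolding r e by (rule inj_image_eq_iff)
  then show ?thesis by (simp add: seqs_opp del: opp_sel(7))
qed auto
context additive_bifunctor
begin

lemma additive_bifunctor_opp: "additive_bifunctor (opp C)"
proof (intro additive_bifunctor.intro additive_category.intro category.intro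
    additive_category_axioms.intro additive_bifunctor_axioms.intro)
  fix A B assume "A \<in> Ob (opp C)" "B \<in> Ob (opp C)"
  then obtain P i1 i2 p1 p2 where "is_biproduct C A B (P, i1, i2, p1, p2)"
    using biproduct_exists[of A B] by (metis opp_sel(1) prod_cases5)
  then have "is_biproduct (opp C) A B (P, p1, p2, i1, i2)"
    by auto
  then show "\<exists>S. is_biproduct (opp C) A B S" by blast
next
  show "\<exists>O'. is_zero_object (opp C) O'"
    using zero_object_exists by (simp add: is_zero_object_def conj_commute)
next
  fix Z Z' X X' g f assume a: "Z \<in> Ob (opp C)" "Z' \<in> Ob (opp C)" "X \<in> Ob (opp C)" "X' \<in> Ob (opp C)"
    "g \<in> hom_set (opp C) Z' Z" "f \<in> hom_set (opp C) X X'"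
  show "Ext_map (opp C) g f \<in> hom (Ext (opp C) Z X) (Ext (opp C) Z' X')"
    using a Ext_map_hom by auto
next
  fix X Y X' Y' f
  assume "X \<in> Ob (opp C)" "Y \<in> Ob (opp C)" "X' \<in> Ob (opp C)" "Y' \<in> Ob (opp C)"
    "f \<in> hom_set (opp C) X Y" "f \<in> hom_set (opp C) X' Y'"
  then show "X = X' \<and> Y = Y'" using hom_disjoint by auto
qed (unfold opp_sel, (rule idt_hom cmp_hom cmp_assoc[symmetric] cmp_idt_left cmp_idt_right cmp_add_left
    cmp_add_right hom_group Ext_group Ext_map_idt Ext_map_cmp Ext_map_add_left Ext_map_add_right;
    assumption)+)

lemma is_biproduct_opp: 
  "is_biproduct (opp C) A B (P, i1, i2, p1, p2) \<longleftrightarrow> is_biproduct C A B (P, p1, p2, i1, i2)"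
  by auto

end

context additive_realization
begin

lemma dsum_opp:
  assumes "is_biproduct C A A' (P, i1, i2, p1, p2)" "is_biproduct C B B' (Q, j1, j2, q1, q2)"
    "a \<in> hom_set C A B" "a' \<in> hom_set C A' B'"
  shows "dsum (opp C) (Q, q1, q2, j1, j2) (P, p1, p2, i1, i2) a a' =
    dsum C (P, i1, i2, p1, p2) (Q, j1, j2, q1, q2) a a'"
proof -
  have "arr i1 A P" "arr i2 A' P" "arr p1 P A" "arr p2 P A'" "arr j1 B Q" "arr j2 B' Q" "arr q1 Q B"
    "arr q2 Q B'" "arr a A B" "arr a' A' B'"
    using assms by (auto simp: arr_def)
  note [simp] = this[THEN arrD]
  show ?thesis by simp
qed

lemma additive_realization_opp: "additive_realization (opp C)"
proof -
  interpret op: additive_bifunctor "opp C" by (rule additive_bifunctor_opp)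
  show ?thesis
  proof unfold_locales
    fix Z X \<delta> assume a: "Z \<in> Ob (opp C)" "X \<in> Ob (opp C)" "\<delta> \<in> carrier (Ext (opp C) Z X)"
    then obtain T where T: "T \<in> seqs C Z X" "realize C X Z \<delta> = seq_equiv C Z X `` {T}"
      using realize_class[of X Z \<delta>] by (auto elim!: quotientE)
    obtain f Y g where e: "T = (f, Y, g)" by (cases T)
    have "E_triangle C (Z, f, Y, g, X, \<delta>)" using a T e by auto
    then have "E_triangle (opp C) (X, g, Y, f, Z, \<delta>)" by (simp only: E_triangle_opp)
    then show "realize (opp C) Z X \<delta> \<in> seqs (opp C) X Z // seq_equiv (opp C) X Z"
      unfolding E_triangle.simps by (metis quotientI)
  next
    fix X f Y g Z \<delta> X' f' Y' g' Z' \<delta>' \<alpha> \<gamma>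
    assume "E_triangle (opp C) (X, f, Y, g, Z, \<delta>)" "E_triangle (opp C) (X', f', Y', g', Z', \<delta>')"
      "\<alpha> \<in> hom_set (opp C) X X'" "\<gamma> \<in> hom_set (opp C) Z Z'"
      "push (opp C) Z \<alpha> \<delta> = pull (opp C) X' \<gamma> \<delta>'"
    then show "\<exists>\<beta>\<in>hom_set (opp C) Y Y'.
        cmp (opp C) \<beta> f = cmp (opp C) f' \<alpha> \<and> cmp (opp C) g' \<beta> = cmp (opp C) \<gamma> g"
      unfolding E_triangle_opp using realize_morphism[of Z' g' Y' f' X' \<delta>' Z g Y f X \<delta> \<gamma> \<alpha>] by auto
  next
    fix X Z P i1 i2 p1 p2 assume "is_biproduct (opp C) X Z (P, i1, i2, p1, p2)"
    then have "is_biproduct C X Z (P, p1, p2, i1, i2)" by (simp only: is_biproduct_opp)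
    then have "is_biproduct C Z X (P, p2, p1, i2, i1)"
      using hom_group[of P P]
      by (auto simp: comm_group_def comm_monoid.m_comm cmp_hom)
    then have "E_triangle C (Z, p2, P, i1, X, \<one>\<^bsub>Ext C X Z\<^esub>)" by (rule realize_split)
    then show "E_triangle (opp C) (X, i1, P, p2, Z, \<one>\<^bsub>Ext (opp C) Z X\<^esub>)"
      by (simp only: E_triangle_opp opp_sel)
  next
    fix X f Y g Z \<delta> X' f' Y' g' Z' \<delta>' SX SY SZ
    assume t: "E_triangle (opp C) (X, f, Y, g, Z, \<delta>)" "E_triangle (opp C) (X', f', Y', g', Z', \<delta>')"
      and b: "is_biproduct (opp C) X X' SX" "is_biproduct (opp C) Y Y' SY" "is_biproduct (opp C) Z Z' SZ"
    obtain Px i1 i2 p1 p2 Py j1 j2 q1 q2 Pz k1 k2 r1 r2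
      where [simp]: "SX = (Px, i1, i2, p1, p2)" "SY = (Py, j1, j2, q1, q2)" "SZ = (Pz, k1, k2, r1, r2)"
      by (metis prod_cases5)
    have b': "is_biproduct C X X' (Px, p1, p2, i1, i2)" "is_biproduct C Y Y' (Py, q1, q2, j1, j2)"
        "is_biproduct C Z Z' (Pz, r1, r2, k1, k2)"
      using b by (simp_all only: is_biproduct_opp \<open>SX = _\<close> \<open>SY = _\<close> \<open>SZ = _\<close>)
    have t': "E_triangle C (Z, g, Y, f, X, \<delta>)" "E_triangle C (Z', g', Y', f', X', \<delta>')"
      using t by (simp_all only: E_triangle_opp)
    have h: "g \<in> hom_set C Z Y" "f \<in> hom_set C Y X" "g' \<in> hom_set C Z' Y'" "f' \<in> hom_set C Y' X'"
      using t' by (auto simp: seqs_def)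
    show "E_triangle (opp C) (fst SX, dsum (opp C) SX SY f f', fst SY, dsum (opp C) SY SZ g g',
        fst SZ, ext_dsum (opp C) SZ SX \<delta> \<delta>')"
      using realize_dsum[OF t' b'(3,2,1)] dsum_opp[OF b'(2,1) h(2,4)] dsum_opp[OF b'(3,2) h(1,3)]
      unfolding E_triangle_opp by simp
  qed
qed

end

context extriangulated_category
begin

theorem extriangulated_opp: "extriangulated_category (opp C)"
proof -
  interpret op: additive_realization "opp C" by (rule additive_realization_opp)
  show ?thesis
  proof unfold_locales
    fix X f Y g Z \<delta> X' f' Y' g' Z' \<delta>' \<alpha> \<beta>
    assume "E_triangle (opp C) (X, f, Y, g, Z, \<delta>)" "E_triangle (opp C) (X', f', Y', g', Z', \<delta>')"
      "\<alpha> \<in> hom_set (opp C) X X'" "\<beta> \<in> hom_set (opp C) Y Y'"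
      "cmp (opp C) \<beta> f = cmp (opp C) f' \<alpha>"
    then show "\<exists>\<gamma>. tri_morphism (opp C) (X, f, Y, g, Z, \<delta>) (X', f', Y', g', Z', \<delta>') (\<alpha>, \<beta>, \<gamma>)"
      using ET3_op[of Z' g' Y' f' X' \<delta>' Z g Y f X \<delta> \<beta> \<alpha>]
      unfolding E_triangle_opp tri_morphism.simps by (simp del: E_triangle.simps) metis
  next
    fix X f Y g Z \<delta> X' f' Y' g' Z' \<delta>' \<beta> \<gamma>
    assume "E_triangle (opp C) (X, f, Y, g, Z, \<delta>)" "E_triangle (opp C) (X', f', Y', g', Z', \<delta>')"
      "\<beta> \<in> hom_set (opp C) Y Y'" "\<gamma> \<in> hom_set (opp C) Z Z'"
      "cmp (opp C) \<gamma> g = cmp (opp C) g' \<beta>"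
    then show "\<exists>\<alpha>. tri_morphism (opp C) (X, f, Y, g, Z, \<delta>) (X', f', Y', g', Z', \<delta>') (\<alpha>, \<beta>, \<gamma>)"
      using ET3[of Z' g' Y' f' X' \<delta>' Z g Y f X \<delta> \<gamma> \<beta>]
      unfolding E_triangle_opp tri_morphism.simps by (simp del: E_triangle.simps) metis
  next
    fix A f B g D \<delta> u G v H \<epsilon>
    assume "E_triangle (opp C) (A, f, B, g, D, \<delta>)" "E_triangle (opp C) (B, u, G, v, H, \<epsilon>)"
    then show "\<exists>F m h w q \<theta> \<eta>.
        E_triangle (opp C) (A, m, G, h, F, \<theta>) \<and> E_triangle (opp C) (D, w, F, q, H, \<eta>) \<and>
        m = cmp (opp C) u f \<and> cmp (opp C) w g = cmp (opp C) h u \<and> v = cmp (opp C) q h \<and>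
        pull (opp C) A w \<theta> = \<delta> \<and> push (opp C) H g \<epsilon> = \<eta> \<and>
        push (opp C) F f \<theta> = pull (opp C) B q \<epsilon>"
      using ET4_op[of H v G u B \<epsilon> D g f A \<delta>]
      unfolding E_triangle_opp by (simp del: E_triangle.simps) metis
  next
    fix A m G h F \<theta> D w q H \<eta>
    assume "E_triangle (opp C) (A, m, G, h, F, \<theta>)" "E_triangle (opp C) (D, w, F, q, H, \<eta>)"
    then show "\<exists>B f g u v \<delta> \<epsilon>.
        E_triangle (opp C) (A, f, B, g, D, \<delta>) \<and> E_triangle (opp C) (B, u, G, v, H, \<epsilon>) \<and>
        m = cmp (opp C) u f \<and> cmp (opp C) w g = cmp (opp C) h u \<and> v = cmp (opp C) q h \<and>
        pull (opp C) A w \<theta> = \<delta> \<and> push (opp C) H g \<epsilon> = \<eta> \<and>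
        push (opp C) F f \<theta> = pull (opp C) B q \<epsilon>"
      using ET4[of H q F w D \<eta> h G m A \<theta>]
      unfolding E_triangle_opp by (simp del: E_triangle.simps) metis
  qed
qed

lemma arr_opp [simp]: "additive_category.arr (opp C) f X Y \<longleftrightarrow> arr f Y X"
  using additive_bifunctor_opp
  by (auto simp: additive_bifunctor_def additive_category.arr_def arr_def)

lemma zer_opp [simp]: "additive_category.zer (opp C) X Y = zer Y X"
  using additive_bifunctor_opp
  by (auto simp: additive_bifunctor_def additive_category.zer_def zer_def)

lemma src_tgt_opp:
  assumes "mor f"
  shows "additive_category.src (opp C) f = tgt f" "additive_category.tgt (opp C) f = src f"
proof -
  interpret op: extriangulated_category "opp C" by (rule extriangulated_opp)
  show "op.src f = tgt f" "op.tgt f = src f"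
    using op.arr_src[of f "tgt f" "src f"] op.arr_tgt[of f "tgt f" "src f"] assms
    by (auto simp: arr_iff)
qed

text \<open>Statements that are to be dualized may mention \<open>arr\<close>, \<open>zer\<close> and sums; these translate back as follows.\<close>

lemma add_opp [simp]: "mor f \<Longrightarrow> additive_category.add (opp C) f g = f \<oplus> g"
  using extriangulated_opp
  by (simp add: additive_category.add_def extriangulated_category_def additive_realization_def
      additive_bifunctor_def add_def src_tgt_opp)

lemma tri_opp:
  "E_triangle C (X, f, Y, g, Z, \<delta>) \<Longrightarrow> E_triangle (opp C) (Z, g, Y, f, X, \<delta>)"
  by (simp only: E_triangle_opp)

end

declare E_triangle.simps [simp del] tri_morphism.simps [simp del] is_biproduct.simps [simp del]

section \<open>Exactness and uniqueness\<close>

context extriangulated_category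
begin

lemma triD:
  assumes "E_triangle C (X, f, Y, g, Z, \<delta>)"
  shows "mor f \<and> src f = X \<and> tgt f = Y \<and> mor g \<and> src g = Y \<and> tgt g = Z \<and>
    X \<in> Ob C \<and> Y \<in> Ob C \<and> Z \<in> Ob C \<and> \<delta> \<in> carrier (Ext C Z X)"
proof -
  have "arr f X Y" "arr g Y Z" "\<delta> \<in> carrier (Ext C Z X)"
    using assms by (auto simp: arr_def E_triangle.simps seqs_def)
  then show ?thesis by (auto dest: arrD)
qed

lemma ET3_arr:
  assumes "E_triangle C (X, f, Y, g, Z, \<delta>)" "E_triangle C (X', f', Y', g', Z', \<delta>')"
    "arr \<alpha> X X'" "arr \<beta> Y Y'" "\<beta> \<cdot> f = f' \<cdot> \<alpha>"
  obtains \<gamma> where "arr \<gamma> Z Z'" "g' \<cdot> \<beta> = \<gamma> \<cdot> g" "push C Z \<alpha> \<delta> = pull C X' \<gamma> \<delta>'"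
proof -
  obtain \<gamma> where "tri_morphism C (X, f, Y, g, Z, \<delta>) (X', f', Y', g', Z', \<delta>') (\<alpha>, \<beta>, \<gamma>)"
    using ET3[OF assms(1,2) assms(3,4)[THEN arr_hom] assms(5)] by blast
  then show thesis
    using assms(1,2)[THEN triD] that by (auto simp: tri_morphism.simps arr_def)
qed

lemma realize_morphism_arr:
  assumes "E_triangle C (X, f, Y, g, Z, \<delta>)" "E_triangle C (X', f', Y', g', Z', \<delta>')"
    "arr \<alpha> X X'" "arr \<gamma> Z Z'" "push C Z \<alpha> \<delta> = pull C X' \<gamma> \<delta>'"
  obtains \<beta> where "arr \<beta> Y Y'" "\<beta> \<cdot> f = f' \<cdot> \<alpha>" "g' \<cdot> \<beta> = \<gamma> \<cdot> g"
  using realize_morphism[OF assms(1,2) assms(3,4)[THEN arr_hom] assms(5)] that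
    assms(1,2)[THEN triD] by (auto simp: arr_def)

text \<open>Comparing an arbitrary \<open>\<bbbE>\<close>-triangle with \<open>X = X \<rightarrow> 0\<close> or \<open>0 \<rightarrow> X = X\<close> turns (ET3) and the lifting property of
  the realization into the exactness statements that follow.\<close>

lemma trivial_triangles:
  obtains O' where "O' \<in> Ob C"
    and "\<And>X. X \<in> Ob C \<Longrightarrow> E_triangle C (X, idt C X, X, zer X O', O', \<one>\<^bsub>Ext C O' X\<^esub>)"
    and "\<And>X. X \<in> Ob C \<Longrightarrow> E_triangle C (O', zer O' X, X, idt C X, X, \<one>\<^bsub>Ext C X O'\<^esub>)"
    and "\<And>X. X \<in> Ob C \<Longrightarrow> is_biproduct C X O' (X, idt C X, zer O' X, idt C X, zer X O')"
  using zero_biproduct by (metis bip_swap realize_split)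

lemma tri_cmp_zer:
  assumes "E_triangle C (X, f, Y, g, Z, \<delta>)"
  shows "g \<cdot> f = zer X Z"
proof -
  obtain O' where o: "O' \<in> Ob C" and t: "\<And>X. X \<in> Ob C \<Longrightarrow> E_triangle C (X, idt C X, X, zer X O', O', \<one>\<^bsub>Ext C O' X\<^esub>)"
    using trivial_triangles by metis
  note [simp] = o assms[THEN triD]
  obtain \<gamma> where "arr \<gamma> O' Z" "g \<cdot> f = \<gamma> \<cdot> zer X O'"
    by (rule ET3_arr[OF t assms, of X "idt C X" f]) (auto simp: arr_iff)
  then show ?thesis by (auto dest: arrD)
qed

lemma tri_push_one:
  assumes "E_triangle C (X, f, Y, g, Z, \<delta>)"
  shows "push C Z f \<delta> = \<one>\<^bsub>Ext C Z Y\<^esub>"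
proof -
  obtain O' where o: "O' \<in> Ob C" and t: "\<And>X. X \<in> Ob C \<Longrightarrow> E_triangle C (X, idt C X, X, zer X O', O', \<one>\<^bsub>Ext C O' X\<^esub>)"
    using trivial_triangles by metis
  note [simp] = o assms[THEN triD]
  obtain \<gamma> where "arr \<gamma> Z O'" "push C Z f \<delta> = pull C Y \<gamma> \<one>\<^bsub>Ext C O' Y\<^esub>"
    by (rule ET3_arr[OF assms t, of Y f "idt C Y"]) (auto simp: arr_iff)
  then show ?thesis by (auto dest: arrD)
qed

text \<open>Compare with \<open>0 \<rightarrow> W = W\<close>: the morphism \<open>a\<close> and the zero morphism on \<open>X\<close> extend to a morphism of
  \<open>\<bbbE>\<close>-triangles, whose third component is the factorization.\<close>

lemma cofactor:
  assumes "E_triangle C (X, f, Y, g, Z, \<delta>)" "arr a Y W" "a \<cdot> f = zer X W"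
  obtains c where "arr c Z W" "c \<cdot> g = a"
proof -
  obtain O' where o: "O' \<in> Ob C" and t: "\<And>X. X \<in> Ob C \<Longrightarrow> E_triangle C (O', zer O' X, X, idt C X, X, \<one>\<^bsub>Ext C X O'\<^esub>)"
    using trivial_triangles by metis
  note [simp] = o assms(1)[THEN triD] assms(2)[THEN arrD]
  show thesis
    by (rule ET3_arr[OF assms(1) t, of W "zer X O'" a]) (use assms that in \<open>auto simp: arr_iff\<close>)
qed

text \<open>Compare with \<open>W = W \<rightarrow> 0\<close>: that \<open>a\<^sub>*\<delta>\<close> vanishes is the compatibility that the lifting property of the
  realization asks for.\<close>

lemma extend:
  assumes "E_triangle C (X, f, Y, g, Z, \<delta>)" "arr a X W" "push C Z a \<delta> = \<one>\<^bsub>Ext C Z W\<^esub>"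
  obtains b where "arr b Y W" "b \<cdot> f = a"
proof -
  obtain O' where o: "O' \<in> Ob C" and t: "\<And>X. X \<in> Ob C \<Longrightarrow> E_triangle C (X, idt C X, X, zer X O', O', \<one>\<^bsub>Ext C O' X\<^esub>)"
    using trivial_triangles by metis
  note [simp] = o assms(1)[THEN triD] assms(2)[THEN arrD]
  show thesis
    by (rule realize_morphism_arr[OF assms(1) t, of W a "zer Z O'"]) (use assms that in \<open>auto simp: arr_iff\<close>)
qed

lemma tri_pull_one:
  assumes "E_triangle C (X, f, Y, g, Z, \<delta>)"
  shows "pull C X g \<delta> = \<one>\<^bsub>Ext C Y X\<^esub>"
  using extriangulated_category.tri_push_one[OF extriangulated_opp assms[THEN tri_opp]] by simp

lemma factor:
  assumes "E_triangle C (X, f, Y, g, Z, \<delta>)" "arr a W Y" "g \<cdot> a = zer W Z"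
  obtains c where "arr c W X" "f \<cdot> c = a"
  by (rule extriangulated_category.cofactor[OF extriangulated_opp assms(1)[THEN tri_opp], of a W])
    (use assms that in auto)

lemma lift:
  assumes "E_triangle C (X, f, Y, g, Z, \<delta>)" "arr a W Z" "pull C X a \<delta> = \<one>\<^bsub>Ext C W X\<^esub>"
  obtains b where "arr b W Y" "g \<cdot> b = a"
  by (rule extriangulated_category.extend[OF extriangulated_opp assms(1)[THEN tri_opp], of a W])
    (use assms that in auto)

text \<open>The difference \<open>n = e - 1\<close> kills \<open>f\<close>, hence factors as \<open>a g\<close>; since also \<open>g n = 0\<close>, it has square zero.\<close>

lemma endo_middle_iso:
  assumes t: "E_triangle C (X, f, Y, g, Z, \<delta>)" and e: "arr e Y Y" "e \<cdot> f = f" "g \<cdot> e = g"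
  obtains r where "inverse_arrs e r Y Y"
proof -
  note [simp] = t[THEN triD] e(1)[THEN arrD] e(2,3)
  define n where "n = e \<oplus> \<ominus> idt C Y"
  have n: "arr n Y Y" and [simp]: "n \<cdot> f = zer X Y" "g \<cdot> n = zer Y Z"
    by (auto simp: n_def arr_iff)
  note [simp] = n[THEN arrD]
  obtain a where a: "arr a Z Y" "a \<cdot> g = n"
    using cofactor[OF t n] by auto
  note [simp] = a(1)[THEN arrD]
  have "n \<cdot> n = a \<cdot> (g \<cdot> n)"
    unfolding a(2)[symmetric] by simp
  then have "n \<cdot> n = zer Y Y" by simp
  from inverse_id_plus_square_zero[OF n this] have "inverse_arrs (idt C Y \<oplus> n) (idt C Y \<oplus> \<ominus> n) Y Y" .
  moreover have "idt C Y \<oplus> n = e"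
    unfolding n_def by (simp add: add_left_comm[of "idt C Y" e])
  ultimately show thesis using that by simp
qed

lemma realization_exists:
  assumes "\<delta> \<in> carrier (Ext C Z X)" "Z \<in> Ob C" "X \<in> Ob C"
  obtains f Y g where "E_triangle C (X, f, Y, g, Z, \<delta>)"
proof -
  obtain T where T: "T \<in> seqs C X Z" "realize C Z X \<delta> = seq_equiv C X Z `` {T}"
    using realize_class[of Z X \<delta>] assms by (auto elim!: quotientE)
  obtain f Y g where "T = (f, Y, g)" by (cases T)
  then show thesis using that[of f Y g] assms T by (auto simp: E_triangle.simps)
qed

lemma realization_unique:
  assumes "E_triangle C (X, f, Y, g, Z, \<delta>)" "E_triangle C (X, f', Y', g', Z, \<delta>)"
  obtains b c where "inverse_arrs b c Y Y'" "b \<cdot> f = f'" "g' \<cdot> b = g"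
proof -
  have o: "X \<in> Ob C" "Z \<in> Ob C" using assms(1)[THEN triD] by auto
  have "seq_equiv C X Z `` {(f, Y, g)} = seq_equiv C X Z `` {(f', Y', g')}" "(f', Y', g') \<in> seqs C X Z"
    using assms by (auto simp: E_triangle.simps)
  then have "((f, Y, g), (f', Y', g')) \<in> seq_equiv C X Z"
    using equiv_seq_equiv[OF o] by (metis eq_equiv_class)
  from this o show thesis
    by (rule seq_equivE) (use that in \<open>auto simp: inverse_arrs_def\<close>)
qed

lemma transport_middle:
  assumes t: "E_triangle C (X, f, Y, g, Z, \<delta>)" and i: "inverse_arrs b c Y Y'"
  shows "E_triangle C (X, b \<cdot> f, Y', g \<cdot> c, Z, \<delta>)"
proof -
  note [simp] = t[THEN triD] i[THEN inverse_arrsD]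
  have "((f, Y, g), (b \<cdot> f, Y', g \<cdot> c)) \<in> seq_equiv C X Z"
    by (rule seq_equivI[of _ _ _ _ _ _ _ _ b c]) (auto simp: arr_iff)
  then have "seq_equiv C X Z `` {(f, Y, g)} = seq_equiv C X Z `` {(b \<cdot> f, Y', g \<cdot> c)}"
    "(b \<cdot> f, Y', g \<cdot> c) \<in> seqs C X Z"
    using equiv_class_eq[OF equiv_seq_equiv[of X Z]] by (simp, simp add: seq_equiv_def)
  then show ?thesis using t by (auto simp: E_triangle.simps)
qed

text \<open>Realize the transported extension by some sequence and compare it with the given one in both directions.
  The composites of the two comparison maps fix the maps of the sequences, so they are invertible.\<close>

lemma transport_third:
  assumes t: "E_triangle C (X, f, Y, g, Z, \<delta>)" and i: "inverse_arrs b c Z Z'"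
  shows "E_triangle C (X, f, Y, b \<cdot> g, Z', pull C X c \<delta>)"
proof -
  note [simp] = t[THEN triD] i[THEN inverse_arrsD]
  obtain f0 Y0 g0 where t0: "E_triangle C (X, f0, Y0, g0, Z', pull C X c \<delta>)"
    by (rule realization_exists[of "pull C X c \<delta>" Z' X]) auto
  note [simp] = t0[THEN triD]
  have [simp]: "pull C X b (pull C X c \<delta>) = \<delta>"
    using pull_cmp[of \<delta> c X b] by simp
  obtain \<beta> where \<beta>: "arr \<beta> Y Y0" "\<beta> \<cdot> f = f0" "g0 \<cdot> \<beta> = b \<cdot> g"
    by (rule realize_morphism_arr[OF t t0, of "idt C X" b]) (auto simp: arr_iff)
  obtain \<gamma> where \<gamma>: "arr \<gamma> Y0 Y" "\<gamma> \<cdot> f0 = f" "g \<cdot> \<gamma> = c \<cdot> g0"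
    by (rule realize_morphism_arr[OF t0 t, of "idt C X" c]) (auto simp: arr_iff)
  note [simp] = \<beta>(1)[THEN arrD] \<gamma>(1)[THEN arrD] \<beta>(2,3) \<gamma>(2,3) \<beta>(2,3)[THEN cmp_eq_assoc] \<gamma>(2,3)[THEN cmp_eq_assoc]
  obtain l where l: "inverse_arrs (\<gamma> \<cdot> \<beta>) l Y Y"
    by (rule endo_middle_iso[OF t, of "\<gamma> \<cdot> \<beta>"]) (auto simp: arr_iff)
  obtain r where r: "inverse_arrs (\<beta> \<cdot> \<gamma>) r Y0 Y0"
    by (rule endo_middle_iso[OF t0, of "\<beta> \<cdot> \<gamma>"]) (auto simp: arr_iff)
  have i: "inverse_arrs \<beta> (l \<cdot> \<gamma>) Y Y0"
    by (rule inverse_of_split_both[OF \<beta>(1) \<gamma>(1) l r])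
  have "E_triangle C (X, l \<cdot> \<gamma> \<cdot> f0, Y, g0 \<cdot> \<beta>, Z', pull C X c \<delta>)"
    by (rule transport_middle[OF t0 i[THEN inverse_arrs_sym]])
  moreover have "l \<cdot> \<gamma> \<cdot> f0 = f"
    using i[THEN inverse_arrsD] \<beta>(2) l[THEN inverse_arrsD] by (metis triD[OF t])
  ultimately show ?thesis by simp
qed

text \<open>(ET3) supplies morphisms in both directions that are compatible with the maps from \<open>Y\<close> and with the
  extensions.  An endomorphism \<open>e\<close> of \<open>Z\<close> with \<open>e g = g\<close> and \<open>e\<^sup>*\<delta> = \<delta>\<close> is invertible: \<open>n = e - 1\<close> pulls \<open>\<delta>\<close>
  back to zero, hence factors as \<open>g y\<close>, and \<open>n n = n g y = 0\<close>.\<close>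

lemma cone_unique:
  assumes t: "E_triangle C (X, f, Y, g, Z, \<delta>)" and t': "E_triangle C (X, f, Y, g', Z', \<delta>')"
  obtains b c where "inverse_arrs b c Z Z'" "b \<cdot> g = g'" "pull C X b \<delta>' = \<delta>"
proof -
  have *: "\<exists>r. inverse_arrs e r Z Z" if t: "E_triangle C (X, f, Y, g, Z, \<delta>)"
    and e: "arr e Z Z" "e \<cdot> g = g" "pull C X e \<delta> = \<delta>" for e g Z \<delta>
  proof -
    note [simp] = t[THEN triD] e(1)[THEN arrD] e(2,3)
    define n where "n = e \<oplus> \<ominus> idt C Z"
    have n: "arr n Z Z" and [simp]: "n \<cdot> g = zer Y Z"
      by (auto simp: n_def arr_iff)
    have en: "idt C Z \<oplus> n = e"
      unfolding n_def by (simp add: add_left_comm[of "idt C Z" e])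
    note [simp] = n[THEN arrD]
    interpret G: comm_group "Ext C Z X" using Ext_group by simp
    have "\<delta> \<otimes>\<^bsub>Ext C Z X\<^esub> pull C X n \<delta> = pull C X e \<delta>"
      unfolding en[symmetric] by (subst pull_add) auto
    then have "pull C X n \<delta> = \<one>\<^bsub>Ext C Z X\<^esub>"
      by (metis G.r_cancel_one' G.m_comm e(3) ext_closed(2) \<open>mor n \<and> _\<close> triD[OF t])
    then obtain y where y: "arr y Z Y" "g \<cdot> y = n"
      using lift[OF t n] by auto
    note [simp] = y(1)[THEN arrD]
    have "n \<cdot> n = (n \<cdot> g) \<cdot> y"
      by (simp add: y(2) del: \<open>n \<cdot> g = zer Y Z\<close>)
    then have "n \<cdot> n = zer Z Z" by simp
    from inverse_id_plus_square_zero[OF n this] en show ?thesis by auto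
  qed
  note [simp] = t[THEN triD] t'[THEN triD]
  obtain b where b: "arr b Z Z'" "g' = b \<cdot> g" "\<delta> = pull C X b \<delta>'"
    by (rule ET3_arr[OF t t', of "idt C X" "idt C Y"]) (auto simp: arr_iff)
  obtain c where c: "arr c Z' Z" "g = c \<cdot> g'" "\<delta>' = pull C X c \<delta>"
    by (rule ET3_arr[OF t' t, of "idt C X" "idt C Y"]) (auto simp: arr_iff)
  note [simp] = b(1)[THEN arrD] c(1)[THEN arrD] b(2,3)[symmetric] c(2,3)[symmetric]
  obtain l where l: "inverse_arrs (c \<cdot> b) l Z Z"
    using *[OF t, of "c \<cdot> b"] by (auto simp: arr_iff)
  obtain r where r: "inverse_arrs (b \<cdot> c) r Z' Z'"
    using *[OF t', of "b \<cdot> c"] by (auto simp: arr_iff)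
  show thesis
    by (rule that[OF inverse_of_split_both[OF b(1) c(1) l r]]) simp_all
qed

section \<open>Homotopy cartesian squares\<close>

lemma ET4_arr:
  assumes "E_triangle C (A, f, B, g, D, \<delta>)" "E_triangle C (B, u, G, v, H, \<epsilon>)"
  obtains F h w q \<theta> where "E_triangle C (A, u \<cdot> f, G, h, F, \<theta>)"
    "E_triangle C (D, w, F, q, H, push C H g \<epsilon>)" "w \<cdot> g = h \<cdot> u" "v = q \<cdot> h"
    "pull C A w \<theta> = \<delta>" "push C F f \<theta> = pull C B q \<epsilon>"
  using ET4[OF assms] that by metis

lemma ET4_op_arr:
  assumes "E_triangle C (A, m, G, h, F, \<theta>)" "E_triangle C (D, w, F, q, H, \<eta>)"
  obtains B f g u \<epsilon> where "E_triangle C (A, f, B, g, D, pull C A w \<theta>)"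
    "E_triangle C (B, u, G, q \<cdot> h, H, \<epsilon>)" "m = u \<cdot> f" "w \<cdot> g = h \<cdot> u"
    "push C H g \<epsilon> = \<eta>" "push C F f \<theta> = pull C B q \<epsilon>"
  using ET4_op[OF assms] that by metis

text \<open>The middle term of a split \<open>\<bbbE>\<close>-triangle is a direct sum by definition, but the point here is that the
  section can be prescribed: any \<open>\<sigma>\<close> splitting \<open>g\<close> serves as the second injection.\<close>

lemma split_tri_biproduct:
  assumes t: "E_triangle C (A, f, B, g, D, \<one>\<^bsub>Ext C D A\<^esub>)" and s: "arr \<sigma> D B" "g \<cdot> \<sigma> = idt C D"
  obtains r where "is_biproduct C A D (B, f, \<sigma>, r, g)"
proof -
  note [simp] = t[THEN triD] s(1)[THEN arrD] s(2) cmp_eq_assoc[OF s(2)]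
    tri_cmp_zer[OF t] cmp_eq_assoc[OF tri_cmp_zer[OF t]]
  obtain r0 where r0: "arr r0 B A" "r0 \<cdot> f = idt C A"
    by (rule extend[OF t, of "idt C A" A]) (auto simp: arr_iff)
  note [simp] = r0(1)[THEN arrD] r0(2) cmp_eq_assoc[OF r0(2)]
  obtain e where e: "arr e B A" "f \<cdot> e = idt C B \<oplus> \<ominus> (\<sigma> \<cdot> g)"
    by (rule factor[OF t, of "idt C B \<oplus> \<ominus> (\<sigma> \<cdot> g)" B]) (auto simp: arr_iff)
  note [simp] = e(1)[THEN arrD]
  have r: "e = r0 \<cdot> (f \<cdot> e)" by simp
  have "e \<cdot> f = r0 \<cdot> ((f \<cdot> e) \<cdot> f)" "e \<cdot> \<sigma> = r0 \<cdot> ((f \<cdot> e) \<cdot> \<sigma>)"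
    by (subst r, simp)+
  then have "e \<cdot> f = idt C A" "e \<cdot> \<sigma> = zer D A"
    unfolding e(2) by simp_all
  moreover have "f \<cdot> e \<oplus> \<sigma> \<cdot> g = idt C B"
    unfolding e(2) by simp
  ultimately show thesis
    by (intro that[of e] bipI) (auto simp: arr_iff)
qed

text \<open>This is the direct sum of the given \<open>\<bbbE>\<close>-triangle with \<open>L = L \<rightarrow> 0\<close>.\<close>

lemma tri_dsum_idt:
  assumes t: "E_triangle C (X, f, Y, g, Z, \<delta>)"
    and Q: "is_biproduct C X L (Q, j1, j2, q1, q2)" and P: "is_biproduct C Y L (P, i1, i2, p1, p2)"
  shows "E_triangle C (Q, i1 \<cdot> f \<cdot> q1 \<oplus> i2 \<cdot> q2, P, g \<cdot> p1, Z, push C Z j1 \<delta>)"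
proof -
  obtain O' where o: "O' \<in> Ob C"
    and tr: "\<And>X. X \<in> Ob C \<Longrightarrow> E_triangle C (X, idt C X, X, zer X O', O', \<one>\<^bsub>Ext C O' X\<^esub>)"
    and bi: "\<And>X. X \<in> Ob C \<Longrightarrow> is_biproduct C X O' (X, idt C X, zer O' X, idt C X, zer X O')"
    using trivial_triangles by metis
  note [simp] = o t[THEN triD] Q[THEN bipD] P[THEN bipD]
  have "E_triangle C (Q, (i1 \<cdot> f \<cdot> q1) \<otimes>\<^bsub>Hom C Q P\<^esub> (i2 \<cdot> idt C L \<cdot> q2), P,
      (idt C Z \<cdot> g \<cdot> p1) \<otimes>\<^bsub>Hom C P Z\<^esub> (zer O' Z \<cdot> zer L O' \<cdot> p2), Z,
      Ext_map C (idt C Z) j1 \<delta> \<otimes>\<^bsub>Ext C Z Q\<^esub> Ext_map C (zer Z O') j2 \<one>\<^bsub>Ext C O' L\<^esub>)"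
    using realize_dsum[OF t tr[of L] Q P bi[of Z]] by simp
  moreover have "(i1 \<cdot> f \<cdot> q1) \<otimes>\<^bsub>Hom C Q P\<^esub> (i2 \<cdot> idt C L \<cdot> q2) = i1 \<cdot> f \<cdot> q1 \<oplus> i2 \<cdot> q2"
    by (simp add: add_def)
  moreover have "(idt C Z \<cdot> g \<cdot> p1) \<otimes>\<^bsub>Hom C P Z\<^esub> (zer O' Z \<cdot> zer L O' \<cdot> p2) = g \<cdot> p1 \<oplus> zer P Z"
    by (simp add: add_def)
  moreover have "g \<cdot> p1 \<oplus> zer P Z = g \<cdot> p1" by simp
  moreover have "Ext_map C (zer Z O') j2 \<one>\<^bsub>Ext C O' L\<^esub> = \<one>\<^bsub>Ext C Z Q\<^esub>"
    using ext_one[of j2 "zer Z O'"] by simp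
  moreover have "Ext_map C (idt C Z) j1 \<delta> \<otimes>\<^bsub>Ext C Z Q\<^esub> \<one>\<^bsub>Ext C Z Q\<^esub> = push C Z j1 \<delta>"
    by (simp flip: push_def)
  ultimately show ?thesis by simp
qed

text \<open>Apply (ET4) to the composite \<open>X \<rightarrow> X \<oplus> L \<rightarrow> Y \<oplus> L\<close> of the split inflation \<open>(1; \<alpha>)\<close>, whose cokernel is
  \<open>(\<alpha>, -1)\<close>, and \<open>f \<oplus> 1\<close>.  The composite is \<open>(f; \<alpha>)\<close>, and its cokernel \<open>F\<close> sits in an \<open>\<bbbE>\<close>-triangle
  \<open>L \<rightarrow> F \<rightarrow> Z\<close> that realizes \<open>\<alpha>\<^sub>*\<delta>\<close>, so it can be identified with \<open>E\<close>.\<close>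

lemma homotopy_square:
  assumes t: "E_triangle C (X, f, Y, g, Z, \<delta>)" and a: "arr \<alpha> X L"
    and t': "E_triangle C (L, s, E, t, Z, push C Z \<alpha> \<delta>)"
    and P: "is_biproduct C Y L (P, i1, i2, p1, p2)"
  obtains b where "arr b Y E" "b \<cdot> f = s \<cdot> \<alpha>" "t \<cdot> b = g"
    "E_triangle C (X, i1 \<cdot> f \<oplus> i2 \<cdot> \<alpha>, P, b \<cdot> p1 \<oplus> \<ominus> (s \<cdot> p2), E, pull C X t \<delta>)"
proof -
  note [simp] = t[THEN triD] t'[THEN triD] a[THEN arrD] P[THEN bipD]
  obtain Q j1 j2 q1 q2 where Q: "is_biproduct C X L (Q, j1, j2, q1, q2)"
    by (rule obtain_biproduct[of X L]) auto
  note [simp] = Q[THEN bipD]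
  \<comment> \<open>The shear automorphism of \<open>X \<oplus> L\<close> exhibits \<open>(1; \<alpha>)\<close> as a split inflation.\<close>
  note js = Q[THEN bip_sum]
  have "is_biproduct C X L (Q, j1 \<oplus> j2 \<cdot> \<alpha>, \<ominus> j2, q1, \<alpha> \<cdot> q1 \<oplus> \<ominus> q2)"
  proof (rule bipI)
    show "(j1 \<oplus> j2 \<cdot> \<alpha>) \<cdot> q1 \<oplus> \<ominus> j2 \<cdot> (\<alpha> \<cdot> q1 \<oplus> \<ominus> q2) = idt C Q"
      unfolding js[symmetric] by simp
  qed (auto simp: arr_iff)
  note s = realize_split[OF this]
  obtain F h w q \<theta> where
    m: "E_triangle C (X, (i1 \<cdot> f \<cdot> q1 \<oplus> i2 \<cdot> q2) \<cdot> (j1 \<oplus> j2 \<cdot> \<alpha>), P, h, F, \<theta>)"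
    and w: "E_triangle C (L, w, F, q, Z, push C Z (\<alpha> \<cdot> q1 \<oplus> \<ominus> q2) (push C Z j1 \<delta>))"
    and e: "w \<cdot> (\<alpha> \<cdot> q1 \<oplus> \<ominus> q2) = h \<cdot> (i1 \<cdot> f \<cdot> q1 \<oplus> i2 \<cdot> q2)" "g \<cdot> p1 = q \<cdot> h"
      "push C F (j1 \<oplus> j2 \<cdot> \<alpha>) \<theta> = pull C Q q (push C Z j1 \<delta>)"
    by (rule ET4_arr[OF s tri_dsum_idt[OF t Q P]]) auto
  note [simp] = m[THEN triD] w[THEN triD]
  have m': "(i1 \<cdot> f \<cdot> q1 \<oplus> i2 \<cdot> q2) \<cdot> (j1 \<oplus> j2 \<cdot> \<alpha>) = i1 \<cdot> f \<oplus> i2 \<cdot> \<alpha>" by simp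
  have "push C Z (\<alpha> \<cdot> q1 \<oplus> \<ominus> q2) (push C Z j1 \<delta>) = push C Z ((\<alpha> \<cdot> q1 \<oplus> \<ominus> q2) \<cdot> j1) \<delta>"
    by (rule push_cmp[symmetric]) auto
  also have "(\<alpha> \<cdot> q1 \<oplus> \<ominus> q2) \<cdot> j1 = \<alpha>" by simp
  finally have w': "E_triangle C (L, w, F, q, Z, push C Z \<alpha> \<delta>)" using w by simp
  \<comment> \<open>The projection to \<open>X\<close> retracts \<open>(1; \<alpha>)\<close>, and so recovers \<open>\<theta>\<close> from the relation in (ET4).\<close>
  have "\<theta> = push C F (q1 \<cdot> (j1 \<oplus> j2 \<cdot> \<alpha>)) \<theta>" by simp
  also have "\<dots> = push C F q1 (pull C Q q (push C Z j1 \<delta>))"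
    unfolding e(3)[symmetric] by (rule push_cmp) auto
  also have "\<dots> = pull C X q \<delta>"
    using push_cmp[of "pull C X q \<delta>" F j1 q1] by simp
  finally have \<theta>: "\<theta> = pull C X q \<delta>" .
  have "w \<cdot> \<alpha> = (w \<cdot> (\<alpha> \<cdot> q1 \<oplus> \<ominus> q2)) \<cdot> j1" "\<ominus> w = (w \<cdot> (\<alpha> \<cdot> q1 \<oplus> \<ominus> q2)) \<cdot> j2"
    by simp_all
  then have w_eq: "w \<cdot> \<alpha> = h \<cdot> (i1 \<cdot> f)" "\<ominus> w = h \<cdot> i2"
    unfolding e by simp_all
  obtain \<phi> \<psi> where i: "inverse_arrs \<phi> \<psi> F E" "\<phi> \<cdot> w = s" "t \<cdot> \<phi> = q"
    by (rule realization_unique[OF w' t'])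
  note [simp] = i(1)[THEN inverse_arrsD] i(2)
  have tr: "E_triangle C (X, i1 \<cdot> f \<oplus> i2 \<cdot> \<alpha>, P, \<phi> \<cdot> h, E, pull C X t \<delta>)"
  proof -
    have "t = q \<cdot> \<psi>" unfolding i(3)[symmetric] by simp
    then have "pull C X t \<delta> = pull C X \<psi> \<theta>" by (simp add: \<theta>)
    then show ?thesis using transport_third[OF m i(1)] unfolding m' by simp
  qed
  have h: "\<phi> \<cdot> h = \<phi> \<cdot> h \<cdot> i1 \<cdot> p1 \<oplus> \<ominus> (s \<cdot> p2)"
  proof -
    note ps = P[THEN bip_sum]
    have "\<phi> \<cdot> h = \<phi> \<cdot> (h \<cdot> (i1 \<cdot> p1 \<oplus> i2 \<cdot> p2))" by (subst ps) simp
    also have "\<dots> = \<phi> \<cdot> h \<cdot> i1 \<cdot> p1 \<oplus> \<phi> \<cdot> ((h \<cdot> i2) \<cdot> p2)" by simp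
    also have "\<phi> \<cdot> ((h \<cdot> i2) \<cdot> p2) = \<ominus> (s \<cdot> p2)"
      unfolding w_eq(2)[symmetric] using cmp_eq_assoc[OF i(2), of p2] by simp
    finally show ?thesis .
  qed
  show thesis
  proof (rule that)
    show "arr (\<phi> \<cdot> h \<cdot> i1) Y E" by (simp add: arr_iff)
    show "\<phi> \<cdot> h \<cdot> i1 \<cdot> f = s \<cdot> \<alpha>"
      using cmp_eq_assoc[OF i(2), of \<alpha>] by (simp flip: w_eq)
    have "t \<cdot> (\<phi> \<cdot> h \<cdot> i1) = (t \<cdot> \<phi>) \<cdot> h \<cdot> i1" by simp
    also have "\<dots> = (g \<cdot> p1) \<cdot> i1" unfolding i(3) e(2) by simp
    finally show "t \<cdot> (\<phi> \<cdot> h \<cdot> i1) = g" by simp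
    show "E_triangle C (X, i1 \<cdot> f \<oplus> i2 \<cdot> \<alpha>, P, \<phi> \<cdot> h \<cdot> i1 \<cdot> p1 \<oplus> \<ominus> (s \<cdot> p2), E, pull C X t \<delta>)"
      using tr h by simp
  qed
qed

lemma tri_dsum_idt_op:
  assumes t: "E_triangle C (X, f, Y, g, Z, \<delta>)"
    and Q: "is_biproduct C Y L (Q, j1, j2, q1, q2)" and P: "is_biproduct C Z L (P, i1, i2, p1, p2)"
  shows "E_triangle C (X, j1 \<cdot> f, Q, i1 \<cdot> g \<cdot> q1 \<oplus> i2 \<cdot> q2, P, pull C X p1 \<delta>)"
proof -
  note [simp] = t[THEN triD] Q[THEN bipD] P[THEN bipD]
  have "E_triangle (opp C) (P, i1 \<cdot> g \<cdot> q1 \<oplus> i2 \<cdot> q2, Q, j1 \<cdot> f, X, pull C X p1 \<delta>)"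
    using extriangulated_category.tri_dsum_idt[OF extriangulated_opp tri_opp[OF t]
        is_biproduct_opp[THEN iffD2, OF P] is_biproduct_opp[THEN iffD2, OF Q]] by simp
  then show ?thesis by (simp add: E_triangle_opp)
qed

text \<open>The kernel of \<open>\<alpha>\<close> is transferred to the opposite side of a homotopy cartesian square.  The
  argument is driven by the square itself and not by \<open>\<bbbE>\<close>-triangles on \<open>f\<close> or \<open>s\<close>, so that in
  \<open>composite_cokernel\<close> it applies along either leg of a square in which one leg is only a deflation.

  The composite of the deflations \<open>1 \<oplus> \<alpha> : Y \<oplus> X \<rightarrow> Y \<oplus> L\<close> and \<open>d = (b, -s)\<close> is a deflation by the dual of
  (ET4), with kernel \<open>B\<close>, where \<open>B\<close> is an extension of \<open>X\<close> by \<open>K\<close> that is pulled back along \<open>\<alpha>\<close> and hence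
  splits.  After a suitable choice of the splitting \<open>\<sigma>\<close>, the inclusion \<open>u : B \<rightarrow> Y \<oplus> X\<close> restricts to
  \<open>(f; 1)\<close> on \<open>X\<close>.  The cokernel of \<open>(f; 1)\<close> is \<open>(1, -f) : Y \<oplus> X \<rightarrow> Y\<close>, so (ET4) for
  \<open>X \<rightarrow> B \<rightarrow> Y \<oplus> X\<close> divides \<open>X\<close> out of both terms and leaves \<open>K \<rightarrow> Y \<rightarrow> E\<close>.\<close>

lemma square_kernel:
  assumes t: "E_triangle C (X, a, P, d, E, \<tau>)" and P: "is_biproduct C Y L (P, i1, i2, p1, p2)"
    and a: "p1 \<cdot> a = f" "p2 \<cdot> a = \<alpha>" and d: "d \<cdot> i1 = b" "d \<cdot> i2 = \<ominus> s" and s: "arr s L E"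
    and k: "E_triangle C (K, k, X, \<alpha>, L, \<kappa>)"
  obtains \<theta> where "E_triangle C (K, f \<cdot> k, Y, b, E, \<theta>)" "pull C K s \<theta> = \<kappa>" "push C E k \<theta> = \<tau>"
proof -
  note [simp] = t[THEN triD] k[THEN triD] P[THEN bipD] s[THEN arrD]
  have "arr f X Y" "arr b Y E"
    unfolding a[symmetric] d[symmetric] by (auto simp: arr_iff)
  note [simp] = this[THEN arrD] a d a[THEN cmp_eq_assoc] d[THEN cmp_eq_assoc]
  have a_col: "a = i1 \<cdot> f \<oplus> i2 \<cdot> \<alpha>"
  proof -
    have "a = (i1 \<cdot> p1 \<oplus> i2 \<cdot> p2) \<cdot> a" unfolding P[THEN bip_sum] by simp
    also have "\<dots> = i1 \<cdot> f \<oplus> i2 \<cdot> \<alpha>" by simp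
    finally show ?thesis .
  qed
  have da: "d \<cdot> a = zer X E" by (rule tri_cmp_zer[OF t])
  obtain Q j1 j2 q1 q2 where Q: "is_biproduct C Y X (Q, j1, j2, q1, q2)"
    by (rule obtain_biproduct[of Y X]) auto
  note [simp] = Q[THEN bipD]
  define H where "H = i2 \<cdot> \<alpha> \<cdot> q2 \<oplus> i1 \<cdot> q1"
  have [simp]: "mor H" "src H = Q" "tgt H = P" by (auto simp: H_def)
  have tH: "E_triangle C (K, j2 \<cdot> k, Q, H, P, pull C K p2 \<kappa>)"
    unfolding H_def by (rule tri_dsum_idt_op[OF k bip_swap[OF Q] bip_swap[OF P]])
  obtain B fB gB u \<epsilon> where
    tB: "E_triangle C (K, fB, B, gB, X, pull C K a (pull C K p2 \<kappa>))"
    and tu: "E_triangle C (B, u, Q, d \<cdot> H, E, \<epsilon>)"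
    and B: "j2 \<cdot> k = u \<cdot> fB" "a \<cdot> gB = H \<cdot> u" "push C E gB \<epsilon> = \<tau>"
      "push C P fB (pull C K p2 \<kappa>) = pull C B d \<epsilon>"
    by (rule ET4_op_arr[OF tH t])
  note [simp] = tB[THEN triD] tu[THEN triD]
  have "pull C K a (pull C K p2 \<kappa>) = pull C K (p2 \<cdot> a) \<kappa>"
    by (rule pull_cmp[symmetric]) auto
  then have \<delta>B: "pull C K a (pull C K p2 \<kappa>) = \<one>\<^bsub>Ext C X K\<^esub>"
    using tri_pull_one[OF k] by simp
  have tB': "E_triangle C (K, fB, B, gB, X, \<one>\<^bsub>Ext C X K\<^esub>)"
    using tB unfolding \<delta>B .
  have gf: "gB \<cdot> fB = zer K X" by (rule tri_cmp_zer[OF tB])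
  \<comment> \<open>The column \<open>(f; 1)\<close>, on which \<open>1 \<oplus> \<alpha>\<close> takes the value \<open>(f; \<alpha>) = a\<close>.\<close>
  define w0 where "w0 = j1 \<cdot> f \<oplus> j2"
  have [simp]: "mor w0" "src w0 = X" "tgt w0 = Q" by (auto simp: w0_def)
  have Hw: "H \<cdot> w0 = a"
    unfolding w0_def H_def a_col by (simp add: add_comm)
  obtain \<sigma>0 where s0: "arr \<sigma>0 X B" "gB \<cdot> \<sigma>0 = idt C X"
    by (rule lift[OF tB', of "idt C X" X]) (auto simp: arr_iff)
  note [simp] = s0(1)[THEN arrD]
  have "H \<cdot> (u \<cdot> \<sigma>0) = (a \<cdot> gB) \<cdot> \<sigma>0" unfolding B(2) by simp
  then have "H \<cdot> (u \<cdot> \<sigma>0) = a" by (simp add: s0(2))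
  then have "H \<cdot> (u \<cdot> \<sigma>0 \<oplus> \<ominus> w0) = zer X P" by (simp add: Hw)
  then obtain e where e: "arr e X K" "j2 \<cdot> k \<cdot> e = u \<cdot> \<sigma>0 \<oplus> \<ominus> w0"
    by (rule factor[OF tH, rotated]) (auto simp: arr_iff)
  note [simp] = e(1)[THEN arrD]
  \<comment> \<open>Any section \<open>\<sigma>\<^sub>0\<close> has \<open>u \<sigma>\<^sub>0\<close> equal to \<open>(f; 1)\<close> up to the kernel \<open>K\<close> of \<open>1 \<oplus> \<alpha>\<close>;
    subtracting this error makes them equal.\<close>
  define \<sigma> where "\<sigma> = \<sigma>0 \<oplus> \<ominus> (fB \<cdot> e)"
  have [simp]: "mor \<sigma>" "src \<sigma> = X" "tgt \<sigma> = B" by (auto simp: \<sigma>_def)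
  have g\<sigma>: "gB \<cdot> \<sigma> = idt C X"
    unfolding \<sigma>_def by (simp add: s0(2) cmp_eq_assoc[OF gf])
  have u\<sigma>: "u \<cdot> \<sigma> = w0"
  proof -
    have "u \<cdot> \<sigma> = u \<cdot> \<sigma>0 \<oplus> \<ominus> ((u \<cdot> fB) \<cdot> e)" unfolding \<sigma>_def by simp
    also have "(u \<cdot> fB) \<cdot> e = u \<cdot> \<sigma>0 \<oplus> \<ominus> w0"
      unfolding B(1)[symmetric] using e(2) by simp
    finally show ?thesis by simp
  qed
  obtain r where bB: "is_biproduct C K X (B, fB, \<sigma>, r, gB)"
    by (rule split_tri_biproduct[OF tB', of \<sigma>]) (auto simp: arr_iff g\<sigma>)
  note [simp] = bB[THEN bipD]
  \<comment> \<open>With the projection \<open>r\<close> to \<open>K\<close> itself, the map \<open>K \<rightarrow> Y\<close> obtained below would be \<open>-f k\<close>.\<close>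
  define \<rho> where "\<rho> = \<ominus> r"
  have [simp]: "mor \<rho>" "src \<rho> = B" "tgt \<rho> = K" by (auto simp: \<rho>_def)
  have "is_biproduct C X K (B, \<sigma>, \<ominus> fB, gB, \<rho>)"
    using bip_sum[OF bB] unfolding \<rho>_def by (intro bipI) (auto simp: arr_iff add_comm)
  then have ts: "E_triangle C (X, \<sigma>, B, \<rho>, K, \<one>\<^bsub>Ext C K X\<^esub>)"
    by (rule realize_split)
  obtain F h w q \<theta> where
    tF: "E_triangle C (X, u \<cdot> \<sigma>, Q, h, F, \<theta>)"
    and tw: "E_triangle C (K, w, F, q, E, push C E \<rho> \<epsilon>)"
    and F: "w \<cdot> \<rho> = h \<cdot> u" "d \<cdot> H = q \<cdot> h"
    by (rule ET4_arr[OF ts tu])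
  note [simp] = tF[THEN triD] tw[THEN triD]
  have "is_biproduct C X Y (Q, w0, j1, q2, q1 \<oplus> \<ominus> (f \<cdot> q2))"
    using bip_sum[OF Q] add_left_comm[of "j1 \<cdot> (f \<cdot> q2)" "j1 \<cdot> q1" "\<ominus> (j1 \<cdot> (f \<cdot> q2))"]
    unfolding w0_def by (intro bipI) (auto simp: arr_iff add_comm)
  then have ty: "E_triangle C (X, w0, Q, q1 \<oplus> \<ominus> (f \<cdot> q2), Y, \<one>\<^bsub>Ext C Y X\<^esub>)"
    by (rule realize_split)
  obtain \<phi> \<psi> where i: "inverse_arrs \<phi> \<psi> F Y" "\<phi> \<cdot> h = q1 \<oplus> \<ominus> (f \<cdot> q2)"
    using cone_unique[OF tF[unfolded u\<sigma>] ty] by metis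
  note [simp] = i(1)[THEN inverse_arrsD]
  have "\<phi> \<cdot> w = f \<cdot> k"
  proof -
    have "w = \<ominus> ((w \<cdot> \<rho>) \<cdot> fB)" by (simp add: \<rho>_def)
    also have "\<dots> = \<ominus> (h \<cdot> (j2 \<cdot> k))" unfolding F(1) B(1) by simp
    finally have "\<phi> \<cdot> w = \<ominus> ((\<phi> \<cdot> h) \<cdot> (j2 \<cdot> k))" by simp
    then show ?thesis unfolding i(2) by simp
  qed
  moreover have "q \<cdot> \<psi> = b"
  proof -
    have "q \<cdot> \<psi> = q \<cdot> \<psi> \<cdot> ((\<phi> \<cdot> h) \<cdot> j1)" unfolding i(2) by simp
    also have "\<dots> = (d \<cdot> H) \<cdot> j1" unfolding F(2) by simp
    also have "\<dots> = b" by (simp add: H_def)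
    finally show ?thesis .
  qed
  ultimately have "E_triangle C (K, f \<cdot> k, Y, b, E, push C E \<rho> \<epsilon>)"
    using transport_middle[OF tw i(1)] by simp
  moreover have "pull C K s (push C E \<rho> \<epsilon>) = \<kappa>"
  proof -
    have "pull C K i2 (pull C K p2 \<kappa>) = \<kappa>" "push C L r (push C L fB \<kappa>) = \<kappa>"
      using pull_cmp[of \<kappa> p2 K i2] push_cmp[of \<kappa> L fB r] by simp_all
    then have "\<kappa> = pull C K i2 (push C P r (push C P fB (pull C K p2 \<kappa>)))" by simp
    also have "\<dots> = push C L r (pull C B (d \<cdot> i2) \<epsilon>)"
      unfolding B(4) by (subst pull_cmp) auto
    also have "\<dots> = pull C K (\<ominus> s) (push C E (\<ominus> \<rho>) \<epsilon>)" by (simp add: \<rho>_def)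
    also have "\<dots> = pull C K s (push C E \<rho> \<epsilon>)"
      using pull_neg_push_neg[of \<epsilon> s \<rho>] by simp
    finally show ?thesis by simp
  qed
  moreover have "push C E k (push C E \<rho> \<epsilon>) = \<tau>"
  proof -
    have g: "gB = q2 \<cdot> u \<oplus> k \<cdot> \<rho>"
    proof -
      have "u = u \<cdot> (fB \<cdot> r \<oplus> \<sigma> \<cdot> gB)" unfolding bip_sum[OF bB] by simp
      also have "\<dots> = (u \<cdot> fB) \<cdot> r \<oplus> (u \<cdot> \<sigma>) \<cdot> gB" by simp
      finally have "u = (j2 \<cdot> k) \<cdot> r \<oplus> w0 \<cdot> gB" unfolding u\<sigma> B(1)[symmetric] .
      then have "q2 \<cdot> u = q2 \<cdot> ((j2 \<cdot> k) \<cdot> r \<oplus> w0 \<cdot> gB)" by (rule arg_cong)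
      then have "q2 \<cdot> u = k \<cdot> r \<oplus> gB" by (simp add: w0_def)
      then show ?thesis by (simp add: \<rho>_def add_comm[of _ "\<ominus> (k \<cdot> r)"])
    qed
    have "push C E (q2 \<cdot> u) \<epsilon> = \<one>\<^bsub>Ext C E X\<^esub>"
      using tri_push_one[OF tu] by simp
    moreover have "push C E (q2 \<cdot> u \<oplus> k \<cdot> \<rho>) \<epsilon> =
        push C E (q2 \<cdot> u) \<epsilon> \<otimes>\<^bsub>Ext C E (tgt (q2 \<cdot> u))\<^esub> push C E (k \<cdot> \<rho>) \<epsilon>"
      by (rule push_add) auto
    ultimately show ?thesis
      unfolding g[symmetric] B(3) by simp
  qed
  ultimately show thesis by (rule that)
qed

text \<open>The inflation \<open>(f; \<alpha>)\<close> does not distinguish between \<open>f\<close> and \<open>\<alpha>\<close>.  Pushing \<open>X \<rightarrow> L \<rightarrow> D\<close> forward along \<open>f\<close>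
  gives another homotopy cartesian square on the same two maps, and its fourth corner is isomorphic to
  \<open>E\<close> because both are cokernels of \<open>(f; \<alpha>)\<close>.\<close>

lemma square_cokernel:
  assumes t: "E_triangle C (X, a, P, d, E, \<tau>)" and P: "is_biproduct C Y L (P, i1, i2, p1, p2)"
    and a: "p1 \<cdot> a = f" "p2 \<cdot> a = \<alpha>" and d: "d \<cdot> i1 = b" "d \<cdot> i2 = \<ominus> s" and s: "arr s L E"
    and c: "E_triangle C (X, \<alpha>, L, p, D, \<epsilon>)"
  obtains c where "E_triangle C (Y, b, E, c, D, push C D f \<epsilon>)" "c \<cdot> s = p"
proof -
  note [simp] = t[THEN triD] c[THEN triD] P[THEN bipD] s[THEN arrD]
  have fb: "arr f X Y" "arr b Y E"
    unfolding a[symmetric] d[symmetric] by (auto simp: arr_iff)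
  note [simp] = this[THEN arrD] a d
  have a_col: "a = i1 \<cdot> f \<oplus> i2 \<cdot> \<alpha>"
  proof -
    have "a = (i1 \<cdot> p1 \<oplus> i2 \<cdot> p2) \<cdot> a" unfolding P[THEN bip_sum] by simp
    also have "\<dots> = i1 \<cdot> f \<oplus> i2 \<cdot> \<alpha>" by simp
    finally show ?thesis .
  qed
  obtain b' E' c' where t': "E_triangle C (Y, b', E', c', D, push C D f \<epsilon>)"
    by (rule realization_exists[of "push C D f \<epsilon>" D Y]) auto
  note [simp] = t'[THEN triD]
  obtain s' where s': "arr s' L E'" "s' \<cdot> \<alpha> = b' \<cdot> f" "c' \<cdot> s' = p"
    and tE: "E_triangle C (X, i2 \<cdot> \<alpha> \<oplus> i1 \<cdot> f, P, s' \<cdot> p2 \<oplus> \<ominus> (b' \<cdot> p1), E', pull C X c' \<epsilon>)"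
    by (rule homotopy_square[OF c fb(1) t' bip_swap[OF P]])
  note [simp] = s'(1)[THEN arrD]
  have tE': "E_triangle C (X, a, P, s' \<cdot> p2 \<oplus> \<ominus> (b' \<cdot> p1), E', pull C X c' \<epsilon>)"
    using tE unfolding a_col by (simp add: add_comm)
  obtain \<phi> \<psi> where i: "inverse_arrs \<phi> \<psi> E' E" "\<phi> \<cdot> (s' \<cdot> p2 \<oplus> \<ominus> (b' \<cdot> p1)) = d"
    using cone_unique[OF tE' t] by metis
  note [simp] = i(1)[THEN inverse_arrsD]
  \<comment> \<open>The second square has its sign on the other summand, so that \<open>-\<phi>\<close> is the
    isomorphism compatible with the maps from \<open>Y\<close> and \<open>L\<close>.\<close>
  have "\<phi> \<cdot> s' = \<ominus> s" "\<ominus> (\<phi> \<cdot> b') = b"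
    unfolding d(1)[symmetric] d(2)[symmetric] i(2)[symmetric] by simp_all
  then have n: "\<ominus> (\<phi> \<cdot> b') = b" "s = \<ominus> (\<phi> \<cdot> s')" by simp_all
  have "inverse_arrs (\<ominus> \<phi>) (\<ominus> \<psi>) E' E"
    by (simp add: inverse_arrs_def arr_iff)
  from transport_middle[OF t' this] show thesis
    by (intro that[of "c' \<cdot> \<ominus> \<psi>"]) (simp_all add: n s'(3))
qed

lemma transport_biproduct:
  assumes S: "is_biproduct C A B (P, i1, i2, p1, p2)" and T: "is_biproduct C A B (Q, j1, j2, q1, q2)"
    and t: "E_triangle C (X, i1 \<cdot> a \<oplus> i2 \<cdot> a', P, b \<cdot> p1 \<oplus> b' \<cdot> p2, Z, \<tau>)"
    and a: "arr a X A" "arr a' X B" "arr b A Z" "arr b' B Z"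
  shows "E_triangle C (X, j1 \<cdot> a \<oplus> j2 \<cdot> a', Q, b \<cdot> q1 \<oplus> b' \<cdot> q2, Z, \<tau>)"
proof -
  note [simp] = S[THEN bipD] T[THEN bipD] a[THEN arrD]
  have "inverse_arrs (j1 \<cdot> p1 \<oplus> j2 \<cdot> p2) (i1 \<cdot> q1 \<oplus> i2 \<cdot> q2) P Q"
    using bip_sum[OF S] bip_sum[OF T] by (simp add: inverse_arrs_def arr_iff)
  from transport_middle[OF t this] show ?thesis by simp
qed

section \<open>Pushing forward and pulling back along inflations that are deflations\<close>

text \<open>A kernel and a cokernel of \<open>\<alpha>\<close> become a kernel and a cokernel of the parallel side \<open>b\<close>.  One \<open>b\<close> must
  serve for all the \<open>\<bbbE>\<close>-triangles at once; this works since \<open>square_kernel\<close> and \<open>square_cokernel\<close> take the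
  square as given.\<close>

lemma bicartesian_pushout:
  assumes t: "E_triangle C (X, f, Y, g, Z, \<delta>)" and a: "arr \<alpha> X L"
    and t': "E_triangle C (L, s, E, t, Z, push C Z \<alpha> \<delta>)"
    and k: "E_triangle C (K, k, X, \<alpha>, L, \<kappa>)" and c: "E_triangle C (X, \<alpha>, L, p, D, \<epsilon>)"
  obtains b c \<theta> where "arr b Y E" "b \<cdot> f = s \<cdot> \<alpha>" "t \<cdot> b = g"
    "\<forall>S. is_biproduct C Y L S \<longrightarrow> E_triangle C (X, col C X S f \<alpha>, fst S,
        row C E S b (inv\<^bsub>Hom C L E\<^esub> s), E, pull C X t \<delta>)"
    "E_triangle C (K, f \<cdot> k, Y, b, E, \<theta>)" "pull C K s \<theta> = \<kappa>" "push C E k \<theta> = pull C X t \<delta>"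
    "E_triangle C (Y, b, E, c, D, push C D f \<epsilon>)" "c \<cdot> s = p"
proof -
  note [simp] = t[THEN triD] t'[THEN triD] a[THEN arrD] k[THEN triD] c[THEN triD]
  obtain P i1 i2 p1 p2 where P: "is_biproduct C Y L (P, i1, i2, p1, p2)"
    by (rule obtain_biproduct[of Y L]) auto
  note [simp] = P[THEN bipD]
  obtain b where b: "arr b Y E" "b \<cdot> f = s \<cdot> \<alpha>" "t \<cdot> b = g"
    and sq: "E_triangle C (X, i1 \<cdot> f \<oplus> i2 \<cdot> \<alpha>, P, b \<cdot> p1 \<oplus> \<ominus> (s \<cdot> p2), E, pull C X t \<delta>)"
    by (rule homotopy_square[OF t a t' P])
  note [simp] = b(1)[THEN arrD]
  have all: "\<forall>S. is_biproduct C Y L S \<longrightarrow> E_triangle C (X, col C X S f \<alpha>, fst S,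
        row C E S b (inv\<^bsub>Hom C L E\<^esub> s), E, pull C X t \<delta>)"
  proof (intro allI impI)
    fix S assume S: "is_biproduct C Y L S"
    obtain Q j1 j2 q1 q2 where e: "S = (Q, j1, j2, q1, q2)" by (cases S)
    note S' = S[unfolded e]
    note [simp] = S'[THEN bipD]
    have "E_triangle C (X, j1 \<cdot> f \<oplus> j2 \<cdot> \<alpha>, Q, b \<cdot> q1 \<oplus> \<ominus> s \<cdot> q2, E, pull C X t \<delta>)"
      by (rule transport_biproduct[OF P S']) (use sq in \<open>simp_all add: arr_iff\<close>)
    moreover have "col C X S f \<alpha> = j1 \<cdot> f \<oplus> j2 \<cdot> \<alpha>"
      by (simp add: e add_def)
    moreover have "row C E S b (inv\<^bsub>Hom C L E\<^esub> s) = b \<cdot> q1 \<oplus> \<ominus> s \<cdot> q2"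
      by (simp add: e add_def neg_def del: cmp_neg)
    ultimately show "E_triangle C (X, col C X S f \<alpha>, fst S,
        row C E S b (inv\<^bsub>Hom C L E\<^esub> s), E, pull C X t \<delta>)"
      by (simp add: e)
  qed
  have m: "p1 \<cdot> (i1 \<cdot> f \<oplus> i2 \<cdot> \<alpha>) = f" "p2 \<cdot> (i1 \<cdot> f \<oplus> i2 \<cdot> \<alpha>) = \<alpha>"
    "(b \<cdot> p1 \<oplus> \<ominus> (s \<cdot> p2)) \<cdot> i1 = b" "(b \<cdot> p1 \<oplus> \<ominus> (s \<cdot> p2)) \<cdot> i2 = \<ominus> s" and s: "arr s L E"
    by (simp_all add: arr_iff)
  obtain \<theta> where \<theta>: "E_triangle C (K, f \<cdot> k, Y, b, E, \<theta>)" "pull C K s \<theta> = \<kappa>"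
    "push C E k \<theta> = pull C X t \<delta>"
    by (rule square_kernel[OF sq P m s k])
  obtain c' where c': "E_triangle C (Y, b, E, c', D, push C D f \<epsilon>)" "c' \<cdot> s = p"
    by (rule square_cokernel[OF sq P m s c])
  show thesis by (rule that[OF b all \<theta> c'])
qed

lemma bicartesian_pullback:
  assumes t: "E_triangle C (L, u, M, v, N, \<epsilon>)" and a: "arr \<gamma> Z N"
    and t': "E_triangle C (L, s, E, t, Z, pull C L \<gamma> \<epsilon>)"
    and k: "E_triangle C (K, k, Z, \<gamma>, N, \<kappa>)" and c: "E_triangle C (Z, \<gamma>, N, p, D, \<zeta>)"
  obtains b j \<theta> where "arr b E M" "v \<cdot> b = \<gamma> \<cdot> t" "b \<cdot> s = u"
    "\<forall>S. is_biproduct C Z M S \<longrightarrow> E_triangle C (E, col C E S (inv\<^bsub>Hom C E Z\<^esub> t) b, fst S,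
        row C N S \<gamma> v, N, push C N s \<epsilon>)"
    "E_triangle C (E, b, M, p \<cdot> v, D, \<theta>)" "push C D t \<theta> = \<zeta>" "pull C E p \<theta> = push C N s \<epsilon>"
    "E_triangle C (K, j, E, b, M, pull C K v \<kappa>)" "t \<cdot> j = k"
proof -
  note [simp] = t[THEN triD] t'[THEN triD] a[THEN arrD] k[THEN triD] c[THEN triD]
  have h: "E_triangle (opp C) (Z, t, E, s, L, push (opp C) L \<gamma> \<epsilon>)"
    using tri_opp[OF t'] by simp
  obtain b j \<theta> where b: "arr b E M" "v \<cdot> b = \<gamma> \<cdot> t" "b \<cdot> s = u"
    and sq: "\<forall>S. is_biproduct (opp C) M Z S \<longrightarrow> E_triangle (opp C) (N, col (opp C) N S v \<gamma>, fst S,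
        row (opp C) E S b (inv\<^bsub>Hom (opp C) Z E\<^esub> t), E, pull (opp C) N s \<epsilon>)"
    and r: "E_triangle C (E, b, M, p \<cdot> v, D, \<theta>)" "push C D t \<theta> = \<zeta>" "pull C E p \<theta> = push C N s \<epsilon>"
    "E_triangle C (K, j, E, b, M, pull C K v \<kappa>)" "t \<cdot> j = k"
    by (rule extriangulated_category.bicartesian_pushout[OF extriangulated_opp tri_opp[OF t] _ h tri_opp[OF c] tri_opp[OF k]])
      (use a in \<open>auto simp: E_triangle_opp\<close>)
  note [simp] = b(1)[THEN arrD]
  have "\<forall>S. is_biproduct C Z M S \<longrightarrow> E_triangle C (E, col C E S (inv\<^bsub>Hom C E Z\<^esub> t) b, fst S,
        row C N S \<gamma> v, N, push C N s \<epsilon>)"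
  proof (intro allI impI)
    fix S assume S: "is_biproduct C Z M S"
    obtain Q j1 j2 q1 q2 where e: "S = (Q, j1, j2, q1, q2)" by (cases S)
    note S' = S[unfolded e]
    note [simp] = S'[THEN bipD]
    \<comment> \<open>The dual of the square on \<open>v\<close> and \<open>\<gamma>\<close> lists the summands in the order \<open>M\<close>, \<open>Z\<close>.\<close>
    have "is_biproduct (opp C) M Z (Q, q2, q1, j2, j1)"
      using is_biproduct_opp bip_swap[OF S'] by blast
    then have "E_triangle C (E, (j2 \<cdot> b) \<otimes>\<^bsub>Hom C E Q\<^esub> (j1 \<cdot> \<ominus> t), Q,
        (v \<cdot> q2) \<otimes>\<^bsub>Hom C Q N\<^esub> (\<gamma> \<cdot> q1), N, push C N s \<epsilon>)"
      using sq[rule_format, of "(Q, q2, q1, j2, j1)"]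
      by (simp add: E_triangle_opp neg_def del: cmp_neg)
    moreover have "(j2 \<cdot> b) \<otimes>\<^bsub>Hom C E Q\<^esub> (j1 \<cdot> \<ominus> t) = j2 \<cdot> b \<oplus> j1 \<cdot> \<ominus> t"
      by (simp add: add_def)
    moreover have "\<dots> = j1 \<cdot> \<ominus> t \<oplus> j2 \<cdot> b"
      by (rule add_comm) auto
    moreover have "(v \<cdot> q2) \<otimes>\<^bsub>Hom C Q N\<^esub> (\<gamma> \<cdot> q1) = v \<cdot> q2 \<oplus> \<gamma> \<cdot> q1"
      by (simp add: add_def)
    moreover have "\<dots> = \<gamma> \<cdot> q1 \<oplus> v \<cdot> q2"
      by (rule add_comm) auto
    moreover have "inv\<^bsub>Hom C E Z\<^esub> t = \<ominus> t"
      by (simp add: neg_def)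
    moreover from this have "col C E S (inv\<^bsub>Hom C E Z\<^esub> t) b = j1 \<cdot> \<ominus> t \<oplus> j2 \<cdot> b"
      by (simp add: e add_def del: cmp_neg)
    moreover have "row C N S \<gamma> v = \<gamma> \<cdot> q1 \<oplus> v \<cdot> q2"
      by (simp add: e add_def)
    ultimately show "E_triangle C (E, col C E S (inv\<^bsub>Hom C E Z\<^esub> t) b, fst S,
        row C N S \<gamma> v, N, push C N s \<epsilon>)"
      by (simp add: e)
  qed
  then show thesis by (rule that[OF b _ r])
qed

section \<open>Composites of inflations that are deflations\<close>

text \<open>This is (ET4) for \<open>Y \<rightarrow> E \<rightarrow> M\<close>, sharpened by an \<open>\<bbbE>\<close>-triangle \<open>K \<rightarrow> D \<rightarrow> F\<close> for the same \<open>u'\<close>.  The square on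
  \<open>b'\<close> and \<open>c\<close> obtained by pushing \<open>E \<rightarrow> M \<rightarrow> G\<close> forward along \<open>c\<close> is homotopy cartesian.  Transferring the
  kernel \<open>Y\<close> of \<open>c\<close> gives the \<open>\<bbbE>\<close>-triangle on \<open>b' b\<close>, and transferring the kernel \<open>K\<close> of \<open>b'\<close> gives the
  one on \<open>u'\<close>.\<close>

lemma composite_cokernel:
  assumes c: "E_triangle C (Y, b, E, c, D, \<nu>)" and d: "E_triangle C (E, b', M, m, G, \<mu>)"
    and k: "E_triangle C (K, k, E, b', M, \<kappa>)"
  obtains u' F v' p \<zeta> \<xi> where "E_triangle C (D, u', F, v', G, push C G c \<mu>)"
    "E_triangle C (Y, b' \<cdot> b, M, p, F, \<zeta>)" "E_triangle C (K, c \<cdot> k, D, u', F, \<xi>)"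
    "arr p M F" "p \<cdot> b' = u' \<cdot> c" "v' \<cdot> p = m" "pull C Y u' \<zeta> = \<nu>" "push C F b \<zeta> = pull C E v' \<mu>"
proof -
  note [simp] = c[THEN triD] d[THEN triD] k[THEN triD]
  obtain u' F v' where t: "E_triangle C (D, u', F, v', G, push C G c \<mu>)"
    by (rule realization_exists[of "push C G c \<mu>" G D]) auto
  note [simp] = t[THEN triD]
  obtain P i1 i2 p1 p2 where P: "is_biproduct C M D (P, i1, i2, p1, p2)"
    by (rule obtain_biproduct[of M D]) auto
  note [simp] = P[THEN bipD]
  have arrs: "arr c E D" "arr u' D F" by (auto simp: arr_iff)
  obtain p where p: "arr p M F" "p \<cdot> b' = u' \<cdot> c" "v' \<cdot> p = m"
    and sq: "E_triangle C (E, i1 \<cdot> b' \<oplus> i2 \<cdot> c, P, p \<cdot> p1 \<oplus> \<ominus> (u' \<cdot> p2), F, pull C E v' \<mu>)"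
    by (rule homotopy_square[OF d arrs(1) t P])
  note [simp] = p(1)[THEN arrD]
  have m: "p1 \<cdot> (i1 \<cdot> b' \<oplus> i2 \<cdot> c) = b'" "p2 \<cdot> (i1 \<cdot> b' \<oplus> i2 \<cdot> c) = c"
    "(p \<cdot> p1 \<oplus> \<ominus> (u' \<cdot> p2)) \<cdot> i1 = p" "(p \<cdot> p1 \<oplus> \<ominus> (u' \<cdot> p2)) \<cdot> i2 = \<ominus> u'"
    by simp_all
  obtain \<zeta> where \<zeta>: "E_triangle C (Y, b' \<cdot> b, M, p, F, \<zeta>)" "pull C Y u' \<zeta> = \<nu>"
    "push C F b \<zeta> = pull C E v' \<mu>"
    by (rule square_kernel[OF sq P m arrs(2) c])
  \<comment> \<open>Reading the same square with its two legs exchanged moves the sign to the other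
    summand, which the automorphism \<open>-1\<close> of \<open>F\<close> corrects.\<close>
  have "inverse_arrs (\<ominus> idt C F) (\<ominus> idt C F) F F"
    by (simp add: inverse_arrs_def arr_iff)
  note sq' = transport_third[OF sq this]
  have m': "(\<ominus> idt C F \<cdot> (p \<cdot> p1 \<oplus> \<ominus> (u' \<cdot> p2))) \<cdot> i2 = u'"
    "(\<ominus> idt C F \<cdot> (p \<cdot> p1 \<oplus> \<ominus> (u' \<cdot> p2))) \<cdot> i1 = \<ominus> p"
    by simp_all
  obtain \<xi> where \<xi>: "E_triangle C (K, c \<cdot> k, D, u', F, \<xi>)"
    by (rule square_kernel[OF sq' bip_swap[OF P] m(2,1) m' p(1) k])
  show thesis by (rule that[OF t \<zeta>(1) \<xi> p \<zeta>(2,3)])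
qed

lemma composite_kernel:
  assumes c: "E_triangle C (Y, b, E, c, D, \<nu>)" and d: "E_triangle C (G, j, Y, b, E, \<mu>)"
    and k: "E_triangle C (K, k, E, b', M, \<kappa>)"
  obtains f' F g' i \<zeta> \<xi> where "E_triangle C (G, f', F, g', K, pull C G k \<mu>)"
    "E_triangle C (F, i, Y, b' \<cdot> b, M, \<zeta>)" "E_triangle C (F, g', K, c \<cdot> k, D, \<xi>)"
    "arr i F Y" "b \<cdot> i = k \<cdot> g'" "i \<cdot> f' = j" "push C M g' \<zeta> = \<kappa>" "pull C F b' \<zeta> = push C E f' \<mu>"
  by (rule extriangulated_category.composite_cokernel[OF extriangulated_opp
        tri_opp[OF k] tri_opp[OF d] tri_opp[OF c]])
    (use that in \<open>auto simp: E_triangle_opp\<close>)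

section \<open>The four-by-three diagram\<close>

lemma E_inflation_tri:
  assumes "E_inflation C f" "arr f X Y"
  obtains g Z \<delta> where "E_triangle C (X, f, Y, g, Z, \<delta>)"
  using assms triD unfolding E_inflation_def arr_iff by metis

lemma E_deflation_tri:
  assumes "E_deflation C g" "arr g Y Z"
  obtains X f \<delta> where "E_triangle C (X, f, Y, g, Z, \<delta>)"
  using assms triD unfolding E_deflation_def arr_iff by metis

end

theorem theorem1p3:
  fixes C :: "('o, 'm, 'e) extri_data" (structure)
    and X Y Z L M N :: 'o
    and f g u v \<alpha> \<gamma> :: 'm
    and \<delta> \<epsilon> :: 'e
  assumes "extriangulated_category C"
    and "E_triangle C (X, f, Y, g, Z, \<delta>)"
    and "E_triangle C (L, u, M, v, N, \<epsilon>)"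
    and "\<alpha> \<in> hom_set C X L"
    and "\<gamma> \<in> hom_set C Z N"
    and "push C Z \<alpha> \<delta> = pull C L \<gamma> \<epsilon>"
    and "E_inflation C \<alpha>" and "E_deflation C \<alpha>"
    and "E_inflation C \<gamma>" and "E_deflation C \<gamma>"
  shows "\<exists>\<beta> \<in> hom_set C Y M.
    E_inflation C \<beta> \<and> E_deflation C \<beta> \<and>
    homotopic_morphism C (X, f, Y, g, Z, \<delta>) (L, u, M, v, N, \<epsilon>) (\<alpha>, \<beta>, \<gamma>) \<and>
    (\<exists>K\<^sub>\<alpha> K\<^sub>\<beta> K\<^sub>\<gamma> C\<^sub>\<alpha> C\<^sub>\<beta> C\<^sub>\<gamma> f' g' u' v' i\<^sub>\<alpha> i\<^sub>\<beta> i\<^sub>\<gamma> p\<^sub>\<alpha> p\<^sub>\<beta> p\<^sub>\<gamma> z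
       \<delta>1 \<delta>2 \<delta>3 \<delta>4 \<delta>5 \<delta>6 \<delta>7 \<delta>8 \<delta>9 \<delta>10.
      i\<^sub>\<beta> \<cdot> f' = f \<cdot> i\<^sub>\<alpha> \<and> i\<^sub>\<gamma> \<cdot> g' = g \<cdot> i\<^sub>\<beta> \<and>
      \<beta> \<cdot> f = u \<cdot> \<alpha> \<and> \<gamma> \<cdot> g = v \<cdot> \<beta> \<and>
      p\<^sub>\<beta> \<cdot> u = u' \<cdot> p\<^sub>\<alpha> \<and> p\<^sub>\<gamma> \<cdot> v = v' \<cdot> p\<^sub>\<beta> \<and>
      E_triangle C (K\<^sub>\<alpha>, f', K\<^sub>\<beta>, g', K\<^sub>\<gamma>, \<delta>1) \<and>
      E_triangle C (K\<^sub>\<beta>, g', K\<^sub>\<gamma>, z, C\<^sub>\<alpha>, \<delta>2) \<and>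
      E_triangle C (K\<^sub>\<gamma>, z, C\<^sub>\<alpha>, u', C\<^sub>\<beta>, \<delta>3) \<and>
      E_triangle C (C\<^sub>\<alpha>, u', C\<^sub>\<beta>, v', C\<^sub>\<gamma>, \<delta>4) \<and>
      E_triangle C (K\<^sub>\<alpha>, i\<^sub>\<alpha>, X, \<alpha>, L, \<delta>5) \<and>
      E_triangle C (K\<^sub>\<beta>, i\<^sub>\<beta>, Y, \<beta>, M, \<delta>6) \<and>
      E_triangle C (K\<^sub>\<gamma>, i\<^sub>\<gamma>, Z, \<gamma>, N, \<delta>7) \<and>
      E_triangle C (X, \<alpha>, L, p\<^sub>\<alpha>, C\<^sub>\<alpha>, \<delta>8) \<and>
      E_triangle C (Y, \<beta>, M, p\<^sub>\<beta>, C\<^sub>\<beta>, \<delta>9) \<and>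
      E_triangle C (Z, \<gamma>, N, p\<^sub>\<gamma>, C\<^sub>\<gamma>, \<delta>10) \<and>
      tri_morphism C (X, f, Y, g, Z, \<delta>) (L, u, M, v, N, \<epsilon>) (\<alpha>, \<beta>, \<gamma>) \<and>
      tri_morphism C (K\<^sub>\<alpha>, f', K\<^sub>\<beta>, g', K\<^sub>\<gamma>, \<delta>1) (X, f, Y, g, Z, \<delta>) (i\<^sub>\<alpha>, i\<^sub>\<beta>, i\<^sub>\<gamma>) \<and>
      tri_morphism C (L, u, M, v, N, \<epsilon>) (C\<^sub>\<alpha>, u', C\<^sub>\<beta>, v', C\<^sub>\<gamma>, \<delta>4) (p\<^sub>\<alpha>, p\<^sub>\<beta>, p\<^sub>\<gamma>) \<and>
      tri_morphism C (K\<^sub>\<alpha>, i\<^sub>\<alpha>, X, \<alpha>, L, \<delta>5) (K\<^sub>\<beta>, i\<^sub>\<beta>, Y, \<beta>, M, \<delta>6) (f', f, u) \<and>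
      tri_morphism C (X, \<alpha>, L, p\<^sub>\<alpha>, C\<^sub>\<alpha>, \<delta>8) (Y, \<beta>, M, p\<^sub>\<beta>, C\<^sub>\<beta>, \<delta>9) (f, u, u') \<and>
      tri_morphism C (K\<^sub>\<beta>, i\<^sub>\<beta>, Y, \<beta>, M, \<delta>6) (K\<^sub>\<gamma>, i\<^sub>\<gamma>, Z, \<gamma>, N, \<delta>7) (g', g, v) \<and>
      tri_morphism C (Y, \<beta>, M, p\<^sub>\<beta>, C\<^sub>\<beta>, \<delta>9) (Z, \<gamma>, N, p\<^sub>\<gamma>, C\<^sub>\<gamma>, \<delta>10) (g, v, v'))"
proof -
  interpret extriangulated_category C by fact
  note t1 = assms(2) and t2 = assms(3) and ext = assms(6)
  note [simp] = t1[THEN triD] t2[THEN triD]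
  have \<alpha>: "arr \<alpha> X L" and \<gamma>: "arr \<gamma> Z N"
    using assms(4,5) by (auto intro: arrI)
  note [simp] = \<alpha>[THEN arrD] \<gamma>[THEN arrD]
  obtain Ka ia \<delta>5 where t5: "E_triangle C (Ka, ia, X, \<alpha>, L, \<delta>5)"
    by (rule E_deflation_tri[OF assms(8) \<alpha>])
  obtain pa Ca \<delta>8 where t8: "E_triangle C (X, \<alpha>, L, pa, Ca, \<delta>8)"
    by (rule E_inflation_tri[OF assms(7) \<alpha>])
  obtain Kc ic \<delta>7 where t7: "E_triangle C (Kc, ic, Z, \<gamma>, N, \<delta>7)"
    by (rule E_deflation_tri[OF assms(10) \<gamma>])
  obtain pc Cc \<delta>10 where t10: "E_triangle C (Z, \<gamma>, N, pc, Cc, \<delta>10)"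
    by (rule E_inflation_tri[OF assms(9) \<gamma>])
  note [simp] = t5[THEN triD] t8[THEN triD] t7[THEN triD] t10[THEN triD]
  \<comment> \<open>The intermediate object \<open>E\<close> through which the homotopic morphism factors.\<close>
  obtain s E t where tE: "E_triangle C (L, s, E, t, Z, push C Z \<alpha> \<delta>)"
    by (rule realization_exists[of "push C Z \<alpha> \<delta>" Z L]) auto
  note [simp] = tE[THEN triD]
  obtain b1 c \<theta>1 where b1: "arr b1 Y E" "b1 \<cdot> f = s \<cdot> \<alpha>" "t \<cdot> b1 = g"
    and sq1: "\<forall>S. is_biproduct C Y L S \<longrightarrow> E_triangle C (X, col C X S f \<alpha>, fst S,
        row C E S b1 (inv\<^bsub>Hom C L E\<^esub> s), E, pull C X t \<delta>)"
    and k1: "E_triangle C (Ka, f \<cdot> ia, Y, b1, E, \<theta>1)" "pull C Ka s \<theta>1 = \<delta>5"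
      "push C E ia \<theta>1 = pull C X t \<delta>"
    and c1: "E_triangle C (Y, b1, E, c, Ca, push C Ca f \<delta>8)" "c \<cdot> s = pa"
    by (rule bicartesian_pushout[OF t1 \<alpha> tE t5 t8])
  obtain b2 k \<theta>2 where b2: "arr b2 E M" "v \<cdot> b2 = \<gamma> \<cdot> t" "b2 \<cdot> s = u"
    and sq2: "\<forall>S. is_biproduct C Z M S \<longrightarrow> E_triangle C (E, col C E S (inv\<^bsub>Hom C E Z\<^esub> t) b2,
        fst S, row C N S \<gamma> v, N, push C N s \<epsilon>)"
    and c2: "E_triangle C (E, b2, M, pc \<cdot> v, Cc, \<theta>2)" "push C Cc t \<theta>2 = \<delta>10"
      "pull C E pc \<theta>2 = push C N s \<epsilon>"
    and k2: "E_triangle C (Kc, k, E, b2, M, pull C Kc v \<delta>7)" "t \<cdot> k = ic"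
    by (rule bicartesian_pullback[OF t2 \<gamma> tE[unfolded ext] t7 t10])
  note [simp] = b1(1)[THEN arrD] b2(1)[THEN arrD] k1(1)[THEN triD] c1(1)[THEN triD] c2(1)[THEN triD]
    k2(1)[THEN triD]
  obtain u' Cb v' pb \<delta>9 \<delta>3 where t4: "E_triangle C (Ca, u', Cb, v', Cc, push C Cc c \<theta>2)"
    and t9: "E_triangle C (Y, b2 \<cdot> b1, M, pb, Cb, \<delta>9)"
    and t3: "E_triangle C (Kc, c \<cdot> k, Ca, u', Cb, \<delta>3)"
    and pb: "arr pb M Cb" "pb \<cdot> b2 = u' \<cdot> c" "v' \<cdot> pb = pc \<cdot> v"
      "pull C Y u' \<delta>9 = push C Ca f \<delta>8" "push C Cb b1 \<delta>9 = pull C E v' \<theta>2"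
    by (rule composite_cokernel[OF c1(1) c2(1) k2(1)])
  obtain f' Kb g' ib \<delta>6 \<delta>2 where t1': "E_triangle C (Ka, f', Kb, g', Kc, pull C Ka k \<theta>1)"
    and t6: "E_triangle C (Kb, ib, Y, b2 \<cdot> b1, M, \<delta>6)"
    and t2': "E_triangle C (Kb, g', Kc, c \<cdot> k, Ca, \<delta>2)"
    and ib: "arr ib Kb Y" "b1 \<cdot> ib = k \<cdot> g'" "ib \<cdot> f' = f \<cdot> ia"
      "push C M g' \<delta>6 = pull C Kc v \<delta>7" "pull C Kb b2 \<delta>6 = push C E f' \<theta>1"
    by (rule composite_kernel[OF c1(1) k1(1) k2(1)])
  note [simp] = pb(1)[THEN arrD] ib(1)[THEN arrD] t4[THEN triD] t9[THEN triD] t3[THEN triD]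
    t1'[THEN triD] t6[THEN triD] t2'[THEN triD]

  have left_square: "b2 \<cdot> b1 \<cdot> f = u \<cdot> \<alpha>"
    using cmp_eq_assoc[OF b2(3), of \<alpha>] by (simp add: b1(2))
  have right_square: "v \<cdot> (b2 \<cdot> b1) = \<gamma> \<cdot> g"
    using cmp_eq_assoc[OF b2(2), of b1] by (simp add: b1(3))
  have kernel_square: "ic \<cdot> g' = g \<cdot> ib"
  proof -
    have "ic \<cdot> g' = t \<cdot> (b1 \<cdot> ib)" unfolding k2(2)[symmetric] ib(2) by simp
    also have "\<dots> = g \<cdot> ib" using cmp_eq_assoc[OF b1(3), of ib] by simp
    finally show ?thesis .
  qed
  have cokernel_square: "pb \<cdot> u = u' \<cdot> pa"
  proof -
    have "pb \<cdot> u = (pb \<cdot> b2) \<cdot> s" unfolding b2(3)[symmetric] by simp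
    also have "\<dots> = u' \<cdot> pa" unfolding pb(2) c1(2)[symmetric] by simp
    finally show ?thesis .
  qed
  have mor_abc: "tri_morphism C (X, f, Y, g, Z, \<delta>) (L, u, M, v, N, \<epsilon>) (\<alpha>, b2 \<cdot> b1, \<gamma>)"
    using t1 t2 left_square right_square ext by (simp add: tri_morphism.simps mor_hom)
  have homotopic: "homotopic_morphism C (X, f, Y, g, Z, \<delta>) (L, u, M, v, N, \<epsilon>) (\<alpha>, b2 \<cdot> b1, \<gamma>)"
  proof -
    have "tri_morphism C (X, f, Y, g, Z, \<delta>) (L, s, E, t, Z, push C Z \<alpha> \<delta>) (\<alpha>, b1, idt C Z)"
      using t1 tE b1 by (simp add: tri_morphism.simps mor_hom)
    moreover have "tri_morphism C (L, s, E, t, Z, push C Z \<alpha> \<delta>) (L, u, M, v, N, \<epsilon>) (idt C L, b2, \<gamma>)"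
      using t2 tE b2 ext by (simp add: tri_morphism.simps mor_hom)
    ultimately show ?thesis
      unfolding homotopic_morphism.simps using mor_abc tE sq1 sq2 b1(1)[THEN arr_hom] b2(1)[THEN arr_hom]
      by blast
  qed
  have mor_i: "tri_morphism C (Ka, f', Kb, g', Kc, pull C Ka k \<theta>1) (X, f, Y, g, Z, \<delta>) (ia, ib, ic)"
  proof -
    have "push C Kc ia (pull C Ka k \<theta>1) = pull C X k (push C E ia \<theta>1)" by simp
    also have "\<dots> = pull C X ic \<delta>" unfolding k1(3) k2(2)[symmetric] by simp
    finally show ?thesis
      using t1' t1 ib(3) kernel_square by (simp add: tri_morphism.simps mor_hom)
  qed
  have mor_p: "tri_morphism C (L, u, M, v, N, \<epsilon>) (Ca, u', Cb, v', Cc, push C Cc c \<theta>2) (pa, pb, pc)"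
  proof -
    have "pull C Ca pc (push C Cc c \<theta>2) = push C N c (pull C E pc \<theta>2)" by simp
    also have "\<dots> = push C N pa \<epsilon>" unfolding c2(3) c1(2)[symmetric] by simp
    finally show ?thesis
      using t2 t4 pb(3) cokernel_square by (simp add: tri_morphism.simps mor_hom)
  qed
  have mor_f: "tri_morphism C (Ka, ia, X, \<alpha>, L, \<delta>5) (Kb, ib, Y, b2 \<cdot> b1, M, \<delta>6) (f', f, u)"
  proof -
    have "pull C Kb u \<delta>6 = pull C Kb s (pull C Kb b2 \<delta>6)" unfolding b2(3)[symmetric] by simp
    also have "\<dots> = push C L f' \<delta>5" unfolding ib(5) k1(2)[symmetric] by simp
    finally show ?thesis
      using t5 t6 ib(3) left_square by (simp add: tri_morphism.simps mor_hom)
  qed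
  have mor_u: "tri_morphism C (X, \<alpha>, L, pa, Ca, \<delta>8) (Y, b2 \<cdot> b1, M, pb, Cb, \<delta>9) (f, u, u')"
    using t8 t9 pb(4) left_square cokernel_square by (simp add: tri_morphism.simps mor_hom)
  have mor_g: "tri_morphism C (Kb, ib, Y, b2 \<cdot> b1, M, \<delta>6) (Kc, ic, Z, \<gamma>, N, \<delta>7) (g', g, v)"
    using t6 t7 ib(4) right_square kernel_square by (simp add: tri_morphism.simps mor_hom)
  have mor_v: "tri_morphism C (Y, b2 \<cdot> b1, M, pb, Cb, \<delta>9) (Z, \<gamma>, N, pc, Cc, \<delta>10) (g, v, v')"
  proof -
    have "push C Cb g \<delta>9 = push C Cb t (push C Cb b1 \<delta>9)" unfolding b1(3)[symmetric] by simp
    also have "\<dots> = pull C Z v' \<delta>10" unfolding pb(5) c2(2)[symmetric] by simp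
    finally show ?thesis
      using t9 t10 pb(3) right_square by (simp add: tri_morphism.simps mor_hom)
  qed
  have infl: "E_inflation C (b2 \<cdot> b1)" and defl: "E_deflation C (b2 \<cdot> b1)"
    using t9 t6 unfolding E_inflation_def E_deflation_def by blast+
  have \<beta>: "b2 \<cdot> b1 \<in> hom_set C Y M" by (simp add: mor_hom)
  note squares = ib(3) kernel_square left_square right_square[symmetric] cokernel_square
    pb(3)[symmetric]
  show ?thesis
    by (rule bexI[OF _ \<beta>], intro conjI infl defl homotopic,
      rule exI[of _ Ka], rule exI[of _ Kb], rule exI[of _ Kc], rule exI[of _ Ca],
      rule exI[of _ Cb], rule exI[of _ Cc],
      rule exI[of _ f'], rule exI[of _ g'], rule exI[of _ u'], rule exI[of _ v'],
      rule exI[of _ ia], rule exI[of _ ib], rule exI[of _ ic], rule exI[of _ pa],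
      rule exI[of _ pb], rule exI[of _ pc], rule exI[of _ "c \<cdot> k"],
      rule exI[of _ "pull C Ka k \<theta>1"], rule exI[of _ \<delta>2], rule exI[of _ \<delta>3],
      rule exI[of _ "push C Cc c \<theta>2"], rule exI[of _ \<delta>5], rule exI[of _ \<delta>6],
      rule exI[of _ \<delta>7], rule exI[of _ \<delta>8], rule exI[of _ \<delta>9],
      rule exI[of _ \<delta>10],
      intro conjI squares t1' t2' t3 t4 t5 t6 t7 t8 t9 t10 mor_abc mor_i mor_p mor_f mor_u mor_g mor_v)
qed

end
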